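(* Let $V_->V_+>0$, $0<\rho_-<\rho^*<\rho_+<1$, and $f_-(\rho_-)=f_+(\rho_+)$. Then there exist infinitely many monotone profiles $Q:\mathbb{R}\to(0,1)$ which satisfy the discontinuous delay differential equation $$Q'(x)=\begin{cases}\dfrac{Q(x)^2}{\ell\,\phi(Q(x))}\left[\phi(Q(x))-\phi(Q(x^\sharp))\right], & x^\sharp<0\ \text{or}\ x>0,\\[2mm] \dfrac{Q(x)^2}{\ell\,V_-\phi(Q(x))}\left[V_-\phi(Q(x))-V_+\phi(Q(x^\sharp))\right], & x<0<x^\sharp,\end{cases}\qquad x^\sharp=x+\frac{\ell}{Q(x)},$$ and the boundary conditions $$\lim_{x\to-\infty}Q(x)=\rho_-,\qquad \lim_{x\to+\infty}Q(x)=\rho_+ .$$ Moreover, the graphs of these (distinct) profiles never intersect each other, and $\rho_1^+<Q(0)\le\rho_+$.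
   Context: Standing setting: $\ell>0$ is the car length. $\phi:[0,1]\to[0,1]$ is twice differentiable with $\phi'\le-\hat c_0<0$, $\phi(0)=1$, $\phi(1)=0$, and is such that $f_\pm(\rho)=V_\pm\,\rho\,\phi(\rho)$ satisfy $f_\pm''\le -c_0<0$ for some constant $c_0>0$. $\rho^*\in(0,1)$ is the unique point with $f_-'(\rho^* )=f_+'(\rho^* )=0$. Put $\bar f=f_-(\rho_-)=f_+(\rho_+)$; $\rho_1^+<\rho^*$ is the value with $f_+(\rho_1^+)=\bar f$. Profiles $Q$ are continuous on $\mathbb{R}$, possibly with kinks; the derivative in the equation is understood as a left derivative, and the equation is not imposed at points where $x=0$ or $x^\sharp=0$. *)

theory Defs
  imports "HOL-Analysis.Analysis"
begin

definition flux :: "real \<Rightarrow> (real \<Rightarrow> real) \<Rightarrow> real \<Rightarrow> real" where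
  "flux V \<phi> \<rho> = V * \<rho> * \<phi> \<rho>"

text \<open>Derivative of a function on \<open>[0,1]\<close>, one-sided at the end points; values of the
  function outside \<open>[0,1]\<close> are irrelevant.\<close>

definition unit_deriv :: "(real \<Rightarrow> real) \<Rightarrow> real \<Rightarrow> real" where
  "unit_deriv f \<rho> = vector_derivative f (at \<rho> within {0..1})"

text \<open>The position \<open>x\<^sup>\<sharp>\<close> of the leader of the car located at \<open>x\<close>.\<close>

definition leader :: "real \<Rightarrow> (real \<Rightarrow> real) \<Rightarrow> real \<Rightarrow> real" where
  "leader l Q x = x + l / Q x"

text \<open>The \<open>else\<close> branch is the case \<open>x < 0 < x\<^sup>\<sharp>\<close> whenever neither \<open>x\<close> nor \<open>x\<^sup>\<sharp>\<close> vanishes;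
  points with \<open>x = 0\<close> or \<open>x\<^sup>\<sharp> = 0\<close> are excluded where the equation is imposed.\<close>

definition ftl_rhs :: "real \<Rightarrow> (real \<Rightarrow> real) \<Rightarrow> real \<Rightarrow> real \<Rightarrow> (real \<Rightarrow> real) \<Rightarrow> real \<Rightarrow> real" where
  "ftl_rhs l \<phi> Vm Vp Q x =
     (if leader l Q x < 0 \<or> x > 0
      then (Q x)\<^sup>2 / (l * \<phi> (Q x)) * (\<phi> (Q x) - \<phi> (Q (leader l Q x)))
      else (Q x)\<^sup>2 / (l * Vm * \<phi> (Q x)) * (Vm * \<phi> (Q x) - Vp * \<phi> (Q (leader l Q x))))"

definition ftl_solution :: "real \<Rightarrow> (real \<Rightarrow> real) \<Rightarrow> real \<Rightarrow> real \<Rightarrow> (real \<Rightarrow> real) \<Rightarrow> bool" where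
  "ftl_solution l \<phi> Vm Vp Q \<longleftrightarrow>
     continuous_on UNIV Q \<and>
     (\<forall>x. x \<noteq> 0 \<and> leader l Q x \<noteq> 0 \<longrightarrow>
        (Q has_real_derivative ftl_rhs l \<phi> Vm Vp Q x) (at_left x))"

definition monotone_profiles ::
  "real \<Rightarrow> (real \<Rightarrow> real) \<Rightarrow> real \<Rightarrow> real \<Rightarrow> real \<Rightarrow> real \<Rightarrow> (real \<Rightarrow> real) set" where
  "monotone_profiles l \<phi> Vm Vp \<rho>m \<rho>p =
     {Q. range Q \<subseteq> {0<..<1} \<and> (mono Q \<or> antimono Q) \<and>
         ftl_solution l \<phi> Vm Vp Q \<and>
         (Q \<longlongrightarrow> \<rho>m) at_bot \<and> (Q \<longlongrightarrow> \<rho>p) at_top}"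

end

theory Submission
  imports Defs
begin

text \<open>Put \<open>F = 1 / \<phi>\<close> and let \<open>T = l / f\<close>, where \<open>f\<close> is the common value of the flux at \<open>\<rho>m\<close>
  and \<open>\<rho>p\<close>. The equation says exactly that the time a car needs to reach the present position
  of its leader is constant along the profile, and by the boundary conditions this constant is
  \<open>T\<close>. In this integrated form the problem is order preserving.

  Existence: Knaster--Tarski between a lower and an upper barrier which approach \<open>\<rho>p\<close> like
  \<open>\<rho>p - exp (- 2 \<omega> (x - s)) \<plusminus> exp (- 3 \<omega> (x - s))\<close>; different shifts \<open>s\<close> give different asymptotics and hence
  different profiles. Uniqueness: if two profiles cross at one point, then they cross again between
  that point and its leader, hence in every interval between a later car and its leader. A sliding
  argument with a Harnack inequality shows that they coincide near \<open>+\<infinity>\<close>, and the integrated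
  equation determines a profile backwards. Finally, \<open>Q 0 \<le> \<rho>1\<close> would force a car at \<open>0\<close> to drive
  at constant density, which must then be \<open>\<rho>p > \<rho>1\<close>.\<close>

subsection \<open>Slowness and travel times\<close>

text \<open>A denser road ahead is slower, so the point reached after the time \<open>T\<close>
  moves back towards the car, and the density, \<open>l\<close> over this distance, rises: this is
  why the integrated problem preserves order. Two obstacles shape the rest. The speed law jumps at
  0, so profiles can be translated freely only on the right half-line; sliding takes place there,
  and backward uniqueness transports equality to the left. Moreover all profiles share the limit
  \<open>b\<close>, so near +infinity every difference tends to 0 and the contact sought by the
  sliding argument may occur only at infinity. Differences are therefore measured against the local
  slope of the profile, which stays comparable over bounded windows. The correction term in the
  barriers sits between two scales: it decays faster than the main term and leaves the asymptotics
  alone, but slower than the quadratic error of the linearisation, of size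
  \<open>exp (- 4 \<omega> (x - s))\<close>, so that its sign decides.\<close>

lemma geometric_bound_imp_zero:
  fixes t C :: real
  assumes "\<And>n::nat. \<bar>t\<bar> \<le> C / 2 ^ n"
  shows "t = 0"
proof -
  have "(\<lambda>n::nat. C * (1 / 2) ^ n) \<longlonglongrightarrow> C * 0"
    by (intro tendsto_mult_left LIMSEQ_realpow_zero) auto
  moreover have "\<bar>t\<bar> \<le> C * (1 / 2) ^ n" for n :: nat
    using assms[of n] by (simp add: power_divide)
  ultimately have "\<bar>t\<bar> \<le> C * 0"
    using tendsto_lowerbound[of "\<lambda>n. C * (1 / 2) ^ n" "C * 0" sequentially "\<bar>t\<bar>"]
    by simp
  then show ?thesis by simp
qed

text \<open>Here \<open>a\<close> and \<open>b\<close> stand for \<open>\<rho>m\<close> and \<open>\<rho>p\<close>. Since \<open>F = 1 / \<phi>\<close> and \<open>T\<close> is \<open>l\<close> divided by the common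
  flux, the relation \<open>l * F u < u * V * T\<close> means that the flux at \<open>u\<close> with speed factor \<open>V\<close> exceeds
  the common one; \<open>F b < b * F' b\<close> means that the flux decreases at \<open>b\<close>.\<close>

locale traffic =
  fixes l Vm Vp a b T m M K :: real and F F' :: "real \<Rightarrow> real"
  assumes l_pos: "0 < l" and Vp_pos: "0 < Vp" and Vp_less: "Vp < Vm"
    and a_pos: "0 < a" and a_less: "a < b"
    and F_deriv: "\<And>u. u \<in> {a..b} \<Longrightarrow> (F has_real_derivative F' u) (at u within {a..b})"
    and F'_lower: "\<And>u. u \<in> {a..b} \<Longrightarrow> m \<le> F' u"
    and F'_upper: "\<And>u. u \<in> {a..b} \<Longrightarrow> F' u \<le> M"
    and m_pos: "0 < m" and F_a_pos: "0 < F a" and T_pos: "0 < T"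
    and F'_near_b: "\<And>u. u \<in> {a..b} \<Longrightarrow> \<bar>F' u - F' b\<bar> \<le> K * (b - u)"
    and T_a: "l * F a = a * Vm * T" and T_b: "l * F b = b * Vp * T"
    and flux_above: "\<And>u. a < u \<Longrightarrow> u \<le> b \<Longrightarrow> l * F u < u * Vm * T"
    and F'_b: "F b < b * F' b"
begin

lemma Vm_pos: "0 < Vm" using Vp_pos Vp_less by simp

lemma b_pos: "0 < b" using a_pos a_less by simp

lemma F_mvt:
  assumes "a \<le> u" "u \<le> v" "v \<le> b"
  obtains w where "u \<le> w" "w \<le> v" "F v - F u = F' w * (v - u)"
proof -
  have "\<exists>w\<in>{u..v}. F v - F u = F' w * (v - u)"
  proof (rule mvt_very_simple[OF assms(2)])
    fix x assume "u \<le> x" "x \<le> v"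
    with assms have "(F has_real_derivative F' x) (at x within {u..v})"
      using F_deriv[of x] by (auto intro: has_field_derivative_subset)
    then show "(F has_derivative (*) (F' x)) (at x within {u..v})"
      by (simp add: has_field_derivative_def)
  qed
  then show thesis using that by auto
qed

lemma F_diff_lower:
  assumes "a \<le> u" "u \<le> v" "v \<le> b"
  shows "m * (v - u) \<le> F v - F u"
proof -
  obtain w where "u \<le> w" "w \<le> v" "F v - F u = F' w * (v - u)"
    using F_mvt[OF assms] .
  then show ?thesis using F'_lower[of w] assms by (simp add: mult_right_mono)
qed

lemma F_diff_upper:
  assumes "a \<le> u" "u \<le> v" "v \<le> b"
  shows "F v - F u \<le> M * (v - u)"
proof -
  obtain w where "u \<le> w" "w \<le> v" "F v - F u = F' w * (v - u)"
    using F_mvt[OF assms] .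
  then show ?thesis using F'_upper[of w] assms by (simp add: mult_right_mono)
qed

lemma F_mono: "a \<le> u \<Longrightarrow> u \<le> v \<Longrightarrow> v \<le> b \<Longrightarrow> F u \<le> F v"
  using F_diff_lower[of u v] mult_nonneg_nonneg[of m "v - u"] m_pos by linarith

lemma F_pos: "a \<le> u \<Longrightarrow> u \<le> b \<Longrightarrow> 0 < F u"
  using F_mono[of a u] F_a_pos by simp

lemma M_pos: "0 < M"
  using F'_lower[of a] F'_upper[of a] m_pos a_less by fastforce

lemma F_cont: "continuous_on {a..b} F"
  using F_deriv DERIV_continuous_on by blast

text \<open>The slowness is the reciprocal of the speed at position \<open>z\<close>, so that \<^term>\<open>travel Q x y\<close>
  is the time that a car needs to get from \<open>x\<close> to \<open>y\<close> in the profile \<open>Q\<close>.\<close>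

definition slowness :: "(real \<Rightarrow> real) \<Rightarrow> real \<Rightarrow> real" where
  "slowness Q z = F (Q z) / (if z < 0 then Vm else Vp)"

definition travel :: "(real \<Rightarrow> real) \<Rightarrow> real \<Rightarrow> real \<Rightarrow> real" where
  "travel Q x y = integral {x..y} (slowness Q)"

definition admissible :: "(real \<Rightarrow> real) \<Rightarrow> bool" where
  "admissible Q \<longleftrightarrow> mono Q \<and> range Q \<subseteq> {a..b}"

lemma admissibleD:
  assumes "admissible Q"
  shows "a \<le> Q x" "Q x \<le> b" "x \<le> y \<Longrightarrow> Q x \<le> Q y" "0 < Q x"
  using assms a_pos monoD[of Q x y] unfolding admissible_def
  by (auto simp: image_subset_iff intro: less_le_trans)

text \<open>Crossing the origin replaces \<open>Vm\<close> by the smaller \<open>Vp\<close>, so the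
  jump of the speed law pushes in the same direction as the monotonicity of \<open>F\<close> and
  \<open>Q\<close>.\<close>

lemma slowness_mono:
  assumes "admissible Q" "x \<le> y"
  shows "slowness Q x \<le> slowness Q y"
proof -
  note Q = admissibleD[OF assms(1)]
  have F: "0 < F (Q x)" "F (Q x) \<le> F (Q y)"
    using F_pos F_mono Q assms(2) by auto
  have "1 / (if x < 0 then Vm else Vp) \<le> 1 / (if y < 0 then Vm else Vp)"
    using Vp_pos Vp_less assms(2) by (auto simp: frac_le)
  then show ?thesis
    using F mult_mono[of "F (Q x)" "F (Q y)" "1 / (if x < 0 then Vm else Vp)" "1 / (if y < 0 then Vm else Vp)"]
      Vp_pos Vp_less
    unfolding slowness_def by (auto split: if_splits)
qed

text \<open>The extreme values are \<open>F a / Vm\<close> and \<open>F b / Vp\<close>;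
  \<open>T_a\<close> and \<open>T_b\<close> turn them into multiples of \<open>T / l\<close>, so
  that the distance \<open>l / a\<close> takes at least and \<open>l / b\<close> at most the time
  \<open>T\<close>.\<close>

lemma slowness_bounds:
  assumes "admissible Q"
  shows "a * T / l \<le> slowness Q x" "slowness Q x \<le> b * T / l" "0 < slowness Q x"
proof -
  note Q = admissibleD[OF assms(1)]
  have F: "F a \<le> F (Q x)" "F (Q x) \<le> F b"
    using F_mono Q a_less by auto
  have "a * T / l = F a / Vm" "b * T / l = F b / Vp"
    using T_a T_b l_pos Vp_pos Vm_pos by (auto simp: field_simps)
  moreover have "F a / Vm \<le> slowness Q x" "slowness Q x \<le> F b / Vp"
    unfolding slowness_def using F F_a_pos Vp_pos Vp_less by (auto intro!: frac_le)
  ultimately show "a * T / l \<le> slowness Q x" "slowness Q x \<le> b * T / l" by auto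
  then show "0 < slowness Q x"
    using a_pos T_pos l_pos by (meson divide_pos_pos less_le_trans mult_pos_pos)
qed

lemma slowness_integrable: "admissible Q \<Longrightarrow> slowness Q integrable_on {x..y}"
  by (intro integrable_on_mono_on mono_onI) (auto intro: slowness_mono)

lemma travel_combine:
  assumes "admissible Q" "x \<le> y" "y \<le> z"
  shows "travel Q x z = travel Q x y + travel Q y z"
  unfolding travel_def using Henstock_Kurzweil_Integration.integral_combine[OF assms(2,3) slowness_integrable[OF assms(1)]] by simp

lemma travel_lower:
  assumes "admissible Q" "x \<le> y" "\<And>z. x \<le> z \<Longrightarrow> z \<le> y \<Longrightarrow> c \<le> slowness Q z"
  shows "c * (y - x) \<le> travel Q x y"
  using integral_le[OF integrable_const_ivl[of c x y] slowness_integrable[OF assms(1)]] assms(2,3)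
  unfolding travel_def by (auto simp: mult.commute)

lemma travel_upper:
  assumes "admissible Q" "x \<le> y" "\<And>z. x \<le> z \<Longrightarrow> z \<le> y \<Longrightarrow> slowness Q z \<le> c"
  shows "travel Q x y \<le> c * (y - x)"
  using integral_le[OF slowness_integrable[OF assms(1)] integrable_const_ivl[of c x y]] assms(2,3)
  unfolding travel_def by (auto simp: mult.commute)

lemma travel_bounds:
  assumes "admissible Q" "x \<le> y"
  shows "a * T / l * (y - x) \<le> travel Q x y" "travel Q x y \<le> b * T / l * (y - x)"
  by (rule travel_lower[OF assms] travel_upper[OF assms], rule slowness_bounds[OF assms(1)])+

lemma travel_end_bounds:
  assumes "admissible Q" "x \<le> y"
  shows "slowness Q x * (y - x) \<le> travel Q x y" "travel Q x y \<le> slowness Q y * (y - x)"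
  using travel_lower[OF assms] travel_upper[OF assms] slowness_mono[OF assms(1)] by auto

lemma aT_pos: "0 < a * T / l"
  using a_pos T_pos l_pos by simp

lemma travel_strict_mono:
  assumes "admissible Q" "x \<le> y" "y < z"
  shows "travel Q x y < travel Q x z"
proof -
  have "0 < a * T / l * (z - y)" using aT_pos assms(3) by (intro mult_pos_pos) auto
  then show ?thesis
    using travel_combine[OF assms(1,2), of z] travel_bounds[OF assms(1), of y z] assms(3) by linarith
qed

lemma travel_less_iff:
  assumes "admissible Q" "x \<le> y" "x \<le> z"
  shows "travel Q x y < travel Q x z \<longleftrightarrow> y < z"
  using travel_strict_mono[OF assms(1,2), of z] travel_strict_mono[OF assms(1,3), of y]
  by (cases y z rule: linorder_cases) auto

lemma travel_refl [simp]: "travel Q x x = 0"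
  unfolding travel_def by simp

lemma travel_nonneg: "admissible Q \<Longrightarrow> x \<le> y \<Longrightarrow> 0 \<le> travel Q x y"
  using travel_bounds(1)[of Q x y] aT_pos
  by (meson diff_ge_0_iff_ge less_imp_le mult_nonneg_nonneg order_trans)

section \<open>Comparison of travel times\<close>

lemma slowness_le_add:
  assumes "admissible Q" "admissible P" "Q z \<le> P z + e" "0 \<le> e"
  shows "slowness Q z \<le> slowness P z + M / Vp * e"
proof -
  have F: "F (Q z) \<le> F (P z) + M * e"
  proof (cases "Q z \<le> P z")
    case True
    then show ?thesis using F_mono[of "Q z" "P z"] admissibleD[OF assms(1)] admissibleD[OF assms(2)]
        assms(4) M_pos by (smt (verit) mult_nonneg_nonneg)
  next
    case False
    then have "F (Q z) - F (P z) \<le> M * (Q z - P z)"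
      using F_diff_upper[of "P z" "Q z"] admissibleD[OF assms(1)] admissibleD[OF assms(2)] by simp
    moreover have "M * (Q z - P z) \<le> M * e"
      using assms(3) M_pos by (intro mult_left_mono) auto
    ultimately show ?thesis by linarith
  qed
  define V where "V = (if z < 0 then Vm else Vp)"
  have V: "0 < V" "Vp \<le> V" using Vp_pos Vp_less by (auto simp: V_def)
  have "F (Q z) / V \<le> (F (P z) + M * e) / V"
    using F V(1) by (simp add: divide_right_mono)
  also have "\<dots> = F (P z) / V + M * e / V" by (simp add: add_divide_distrib)
  also have "M * e / V \<le> M * e / Vp"
    using V Vp_pos M_pos assms(4) by (intro divide_left_mono) auto
  finally show ?thesis unfolding slowness_def V_def by simp
qed

lemma slowness_ge_add:
  assumes "admissible Q" "admissible P" "P z + e \<le> Q z" "0 \<le> e"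
  shows "slowness P z + m / Vm * e \<le> slowness Q z"
proof -
  have "m * e \<le> m * (Q z - P z)"
    using assms(3) m_pos by (intro mult_left_mono) auto
  also have "\<dots> \<le> F (Q z) - F (P z)"
    using F_diff_lower[of "P z" "Q z"] admissibleD[OF assms(1)] admissibleD[OF assms(2)] assms(3,4)
    by simp
  finally have F: "F (P z) + m * e \<le> F (Q z)" by simp
  define V where "V = (if z < 0 then Vm else Vp)"
  have V: "0 < V" "V \<le> Vm" using Vp_pos Vp_less by (auto simp: V_def)
  have "m * e / Vm \<le> m * e / V"
    using V Vm_pos m_pos assms(4) by (intro divide_left_mono) auto
  then have "F (P z) / V + m * e / Vm \<le> (F (P z) + m * e) / V"
    by (simp add: add_divide_distrib)
  also have "\<dots> \<le> F (Q z) / V"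
    using F V(1) by (simp add: divide_right_mono)
  finally show ?thesis unfolding slowness_def V_def by simp
qed

lemma travel_le_add:
  assumes "admissible Q" "admissible P" "x \<le> y" "0 \<le> e"
    and "\<And>z. x \<le> z \<Longrightarrow> z \<le> y \<Longrightarrow> Q z \<le> P z + e"
  shows "travel Q x y \<le> travel P x y + M / Vp * e * (y - x)"
proof -
  have "integral {x..y} (slowness Q) \<le> integral {x..y} (\<lambda>z. slowness P z + M / Vp * e)"
    using assms slowness_le_add
    by (intro integral_le integrable_add integrable_const_ivl slowness_integrable) auto
  also have "\<dots> = integral {x..y} (slowness P) + integral {x..y} (\<lambda>_. M / Vp * e)"
    using assms by (intro integral_add slowness_integrable integrable_const_ivl) auto
  finally show ?thesis unfolding travel_def using assms(3) by (simp add: mult_ac)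
qed

lemma travel_ge_add:
  assumes "admissible Q" "admissible P" "x \<le> y" "0 \<le> e"
    and "\<And>z. x \<le> z \<Longrightarrow> z \<le> y \<Longrightarrow> P z + e \<le> Q z"
  shows "travel P x y + m / Vm * e * (y - x) \<le> travel Q x y"
proof -
  have "integral {x..y} (slowness P) + integral {x..y} (\<lambda>_. m / Vm * e)
      = integral {x..y} (\<lambda>z. slowness P z + m / Vm * e)"
    using assms by (intro integral_add[symmetric] slowness_integrable integrable_const_ivl) auto
  also have "\<dots> \<le> integral {x..y} (slowness Q)"
    using assms slowness_ge_add
    by (intro integral_le integrable_add integrable_const_ivl slowness_integrable) auto
  finally show ?thesis unfolding travel_def using assms(3) by (simp add: mult_ac)
qed

lemma travel_le:
  assumes "admissible Q" "admissible P" "x \<le> y" "\<And>z. x \<le> z \<Longrightarrow> z \<le> y \<Longrightarrow> Q z \<le> P z"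
  shows "travel Q x y \<le> travel P x y"
  using travel_le_add[OF assms(1-3), of 0] assms(4) by simp

text \<open>A window of fixed length that moves to the right gives up ground on the left for slower
  ground on the right; the overlap, if any, cancels.\<close>

lemma travel_shift_le:
  assumes Q: "admissible Q" and "x1 \<le> x2" "0 \<le> d"
  shows "travel Q x1 (x1 + d) \<le> travel Q x2 (x2 + d)"
proof (cases "x2 - x1 \<le> d")
  case True
  have "travel Q x1 x2 \<le> slowness Q x2 * (x2 - x1)"
    using travel_end_bounds[OF Q, of x1 x2] assms by auto
  also have "\<dots> \<le> slowness Q (x1 + d) * (x2 - x1)"
    using slowness_mono[OF Q, of x2 "x1 + d"] True assms by (intro mult_right_mono) auto
  also have "\<dots> \<le> travel Q (x1 + d) (x2 + d)"
    using travel_end_bounds[OF Q, of "x1 + d" "x2 + d"] assms by auto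
  finally show ?thesis
    using travel_combine[OF Q, of x1 x2 "x1 + d"] travel_combine[OF Q, of x2 "x1 + d" "x2 + d"] True assms
    by simp
next
  case False
  have "travel Q x1 (x1 + d) \<le> slowness Q (x1 + d) * d"
    using travel_end_bounds[OF Q, of x1 "x1 + d"] assms by auto
  also have "\<dots> \<le> slowness Q x2 * d"
    using slowness_mono[OF Q, of "x1 + d" x2] False assms by (intro mult_right_mono) auto
  also have "\<dots> \<le> travel Q x2 (x2 + d)"
    using travel_end_bounds[OF Q, of x2 "x2 + d"] assms by auto
  finally show ?thesis .
qed

text \<open>The integrated form of the equation: a car catches up with the present position of its
  leader after the time \<open>T\<close>.\<close>

definition sol_on :: "real set \<Rightarrow> (real \<Rightarrow> real) \<Rightarrow> bool" where
  "sol_on S Q \<longleftrightarrow> admissible Q \<and> (\<forall>x\<in>S. travel Q x (leader l Q x) = T)"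

lemma sol_on_subset: "sol_on S Q \<Longrightarrow> S' \<subseteq> S \<Longrightarrow> sol_on S' Q"
  unfolding sol_on_def by auto

lemma leader_bounds:
  assumes "admissible Q"
  shows "x + l / b \<le> leader l Q x" "leader l Q x \<le> x + l / a" "x < leader l Q x"
  using admissibleD[OF assms] l_pos a_pos unfolding leader_def by (auto intro!: frac_le)

text \<open>The stretch from \<open>x1\<close> to the leader of \<open>x2\<close> can be cut at
  \<open>x2\<close> or at the leader of \<open>x1\<close>; both cuts leave a piece of duration
  \<open>T\<close>, so the remaining pieces take equally long.\<close>

lemma leader_travel:
  assumes "sol_on S Q" "x1 \<in> S" "x2 \<in> S" "x1 \<le> x2"
  shows "leader l Q x1 \<le> leader l Q x2"
    and "travel Q (leader l Q x1) (leader l Q x2) = travel Q x1 x2"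
proof -
  let ?y = "leader l Q"
  have Q: "admissible Q" and 1: "travel Q x1 (?y x1) = T" and 2: "travel Q x2 (?y x2) = T"
    using assms unfolding sol_on_def by auto
  note lb = leader_bounds(3)[OF Q]
  have 3: "travel Q x1 (?y x2) = travel Q x1 x2 + T"
    using travel_combine[OF Q assms(4), of "?y x2"] lb[of x2] 2 by simp
  then have "travel Q x1 (?y x1) \<le> travel Q x1 (?y x2)"
    using 1 travel_nonneg[OF Q assms(4)] by simp
  then show le: "?y x1 \<le> ?y x2"
    using travel_less_iff[OF Q, of x1 "?y x2" "?y x1"] lb[of x1] lb[of x2] assms(4) by linarith
  show "travel Q (?y x1) (?y x2) = travel Q x1 x2"
    using travel_combine[OF Q _ le, of x1] lb[of x1] 1 3 by simp
qed

lemma leader_Lipschitz: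
  assumes "sol_on S Q" "x1 \<in> S" "x2 \<in> S" "x1 \<le> x2"
  shows "leader l Q x2 - leader l Q x1 \<le> b / a * (x2 - x1)"
proof -
  let ?y = "leader l Q"
  have Q: "admissible Q" using assms unfolding sol_on_def by auto
  have "T / l * (a * (?y x2 - ?y x1)) = a * T / l * (?y x2 - ?y x1)" by simp
  also have "\<dots> \<le> travel Q (?y x1) (?y x2)"
    using travel_bounds[OF Q leader_travel(1)[OF assms]] by simp
  also have "\<dots> \<le> b * T / l * (x2 - x1)"
    using leader_travel(2)[OF assms] travel_bounds[OF Q assms(4)] by simp
  also have "\<dots> = T / l * (b * (x2 - x1))" by simp
  finally have "a * (?y x2 - ?y x1) \<le> b * (x2 - x1)"
    using T_pos l_pos by (subst (asm) mult_le_cancel_left_pos) auto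
  then show ?thesis
    using a_pos by (simp add: field_simps)
qed

lemma leader_continuous:
  assumes "sol_on S Q"
  shows "continuous_on S (leader l Q)"
proof -
  have "(b / a)-lipschitz_on S (leader l Q)"
  proof (rule lipschitz_onI)
    fix x y assume "x \<in> S" "y \<in> S"
    then show "dist (leader l Q x) (leader l Q y) \<le> b / a * dist x y"
      using leader_Lipschitz[OF assms, of x y] leader_Lipschitz[OF assms, of y x]
        leader_travel(1)[OF assms, of x y] leader_travel(1)[OF assms, of y x]
      by (cases "x \<le> y") (auto simp: dist_real_def)
  qed (use a_pos b_pos in auto)
  then show ?thesis by (rule lipschitz_on_continuous_on)
qed

text \<open>Admissible profiles may jump a priori. The leader's position is Lipschitz, because
  travel times are comparable with distances, and \<open>Q x\<close> is
  \<open>l / (leader l Q x - x)\<close>.\<close>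

lemma sol_continuous:
  assumes "sol_on S Q"
  shows "continuous_on S Q"
proof -
  have Q: "admissible Q" using assms unfolding sol_on_def by auto
  have "continuous_on S (\<lambda>x. l / (leader l Q x - x))"
    using leader_bounds(3)[OF Q]
    by (intro continuous_intros leader_continuous[OF assms]) (simp add: order_less_imp_not_eq2)
  moreover have "l / (leader l Q x - x) = Q x" for x
    using admissibleD(4)[OF Q, of x] l_pos by (simp add: leader_def)
  ultimately show ?thesis by simp
qed

end

subsection \<open>Equivalence with the integrated equation\<close>

text \<open>Only the behaviour to the left of each point is known, so the argument descends: the
  least point of \<open>{p..q}\<close> with value at most \<open>h q\<close> can only be
  \<open>p\<close>.\<close>

lemma le_of_left_decrease:
  fixes h :: "real \<Rightarrow> real"
  assumes "p \<le> q" "continuous_on {p..q} h"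
    and left: "\<And>x. p < x \<Longrightarrow> x \<le> q \<Longrightarrow> \<exists>z\<in>{p..<x}. h z \<le> h x"
  shows "h p \<le> h q"
proof -
  define C where "C = {w \<in> {p..q}. h w \<le> h q}"
  have "C = {p..q} \<inter> h -` {..h q}" unfolding C_def by auto
  then have "closed C"
    using continuous_closed_preimage[OF assms(2), of "{..h q}"] by simp
  moreover have C: "q \<in> C" "bdd_below C"
    using assms(1) unfolding C_def by (auto intro!: bdd_belowI[of _ p])
  ultimately have "Inf C \<in> C"
    using closed_contains_Inf by blast
  moreover have "\<not> p < Inf C"
  proof
    assume "p < Inf C"
    with \<open>Inf C \<in> C\<close> obtain z where "p \<le> z" "z < Inf C" "h z \<le> h (Inf C)"
      using left[of "Inf C"] unfolding C_def by auto
    with \<open>Inf C \<in> C\<close> have "z \<in> C" unfolding C_def by auto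
    then show False using C(2) \<open>z < Inf C\<close> cInf_lower by fastforce
  qed
  ultimately show ?thesis unfolding C_def by (auto simp: order_antisym_conv)
qed

lemma le_of_left_deriv_zero:
  fixes g :: "real \<Rightarrow> real"
  assumes "p \<le> q" "continuous_on {p..q} g"
    and left: "\<And>x. p < x \<Longrightarrow> x \<le> q \<Longrightarrow> (g has_real_derivative 0) (at_left x)"
  shows "g p \<le> g q"
proof (rule field_le_epsilon)
  fix e :: real assume "0 < e"
  define \<epsilon> where "\<epsilon> = e / (q - p + 1)"
  have \<epsilon>: "0 < \<epsilon>" "\<epsilon> * (q - p) \<le> e"
    using \<open>0 < e\<close> assms(1) by (auto simp: \<epsilon>_def field_simps)
  \<comment> \<open>The tilt turns the left derivative 0 into the positive number \<epsilon>, which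
    forces smaller values just to the left.\<close>
  have "g p + \<epsilon> * p \<le> g q + \<epsilon> * q"
  proof (rule le_of_left_decrease[OF assms(1)])
    show "continuous_on {p..q} (\<lambda>x. g x + \<epsilon> * x)"
      by (intro continuous_intros assms)
    fix x assume x: "p < x" "x \<le> q"
    have "((\<lambda>x. g x + \<epsilon> * x) has_real_derivative \<epsilon>) (at_left x)"
      by (rule derivative_eq_intros left[OF x] refl | simp)+
    then obtain d where d: "0 < d" "\<And>h. 0 < h \<Longrightarrow> h < d \<Longrightarrow> g (x - h) + \<epsilon> * (x - h) < g x + \<epsilon> * x"
      using has_real_derivative_pos_inc_left[of "\<lambda>x. g x + \<epsilon> * x" \<epsilon> x "{..<x}"] \<epsilon>(1) by force
    define h where "h = min (d / 2) (x - p)"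
    have "0 < h" "h < d" "h \<le> x - p" using d(1) x by (auto simp: h_def min_def)
    then show "\<exists>z\<in>{p..<x}. g z + \<epsilon> * z \<le> g x + \<epsilon> * x"
      using d(2)[of h] by (intro bexI[of _ "x - h"]) auto
  qed
  then show "g p \<le> g q + e" using \<epsilon>(2) by (simp add: algebra_simps)
qed

text \<open>The derivative is prescribed only in the open interval, since the equation says nothing
  where \<open>x\<close> or its leader is at 0; continuity supplies the value at the end
  point.\<close>

lemma eq_of_left_deriv_zero:
  fixes g :: "real \<Rightarrow> real"
  assumes "p \<le> q" "continuous_on {p..q} g"
    and left: "\<And>x. p < x \<Longrightarrow> x < q \<Longrightarrow> (g has_real_derivative 0) (at_left x)"
  shows "g p = g q"
proof (cases "p = q")
  case False
  have "g x = g p" if "x \<in> {p..<q}" for x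
  proof (rule antisym)
    have cont: "continuous_on {p..x} g"
      using assms(2) by (rule continuous_on_subset) (use that in auto)
    show "g p \<le> g x"
      by (rule le_of_left_deriv_zero[OF _ cont]) (use that left in auto)
    have "- g p \<le> - g x"
    proof (rule le_of_left_deriv_zero[of p x "\<lambda>x. - g x"])
      show "((\<lambda>x. - g x) has_real_derivative 0) (at_left z)" if "p < z" "z \<le> x" for z
        using DERIV_minus[OF left[of z]] that \<open>x \<in> {p..<q}\<close> by simp
    qed (use that continuous_on_minus[OF cont] in auto)
    then show "g x \<le> g p" by simp
  qed
  note const = this
  have clo: "closure {p..<q} = {p..q}"
    using assms(1) False by (intro closure_atLeastLessThan) simp
  have "g q = g p"
  proof (rule continuous_constant_on_closure[OF _ const])
    show "continuous_on (closure {p..<q}) g" unfolding clo by fact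
    show "q \<in> closure {p..<q}" unfolding clo using assms(1) by simp
  qed
  then show ?thesis by simp
qed simp

section \<open>Differentiating the integrated equation and integrating it back\<close>

context traffic
begin

text \<open>An antiderivative of the slowness on the whole line: the integral over an empty interval
  is 0, so at most one of the two terms is active on each side of 0.\<close>

definition cumulative :: "(real \<Rightarrow> real) \<Rightarrow> real \<Rightarrow> real" where
  "cumulative Q x = travel Q 0 x - travel Q x 0"

lemma travel_eq_cumulative:
  assumes "admissible Q" "x \<le> y"
  shows "travel Q x y = cumulative Q y - cumulative Q x"
proof -
  have neg: "travel Q u v = 0" if "v \<le> u" for u v
    using that by (cases "u = v") (auto simp: travel_def)
  consider "0 \<le> x" | "x \<le> 0" "0 \<le> y" | "y \<le> 0" by linarith
  then show ?thesis
  proof cases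
    case 1
    then have "travel Q x 0 = 0" "travel Q y 0 = 0" using neg assms(2) by auto
    with 1 show ?thesis unfolding cumulative_def
      using assms(2) travel_combine[OF assms(1), of 0 x y] by linarith
  next
    case 2
    then have "travel Q 0 x = 0" "travel Q y 0 = 0" using neg by auto
    with 2 show ?thesis unfolding cumulative_def
      using travel_combine[OF assms(1), of x 0 y] by linarith
  next
    case 3
    then have "travel Q 0 x = 0" "travel Q 0 y = 0" using neg assms(2) by auto
    with 3 show ?thesis unfolding cumulative_def
      using assms(2) travel_combine[OF assms(1), of x y 0] by linarith
  qed
qed

lemma cumulative_strict_mono:
  assumes "admissible Q" "x < y"
  shows "cumulative Q x < cumulative Q y"
proof -
  have "0 < travel Q x y" using travel_strict_mono[OF assms(1) order_refl assms(2)] by simp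
  then show ?thesis using travel_eq_cumulative[OF assms(1), of x y] assms(2) by linarith
qed

lemma cumulative_continuous:
  assumes "admissible Q"
  shows "continuous_on UNIV (cumulative Q)"
proof -
  have "(b * T / l)-lipschitz_on UNIV (cumulative Q)"
  proof (rule lipschitz_onI)
    fix x y :: real
    show "dist (cumulative Q x) (cumulative Q y) \<le> b * T / l * dist x y"
      using travel_bounds(2)[OF assms, of x y] travel_bounds(2)[OF assms, of y x]
        travel_nonneg[OF assms, of x y] travel_nonneg[OF assms, of y x]
        travel_eq_cumulative[OF assms, of x y] travel_eq_cumulative[OF assms, of y x]
      by (cases "x \<le> y") (auto simp: dist_real_def)
  qed (use b_pos T_pos l_pos in auto)
  then show ?thesis by (rule lipschitz_on_continuous_on)
qed

lemma cumulative_deriv: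
  assumes "admissible Q" "isCont (slowness Q) x"
  shows "(cumulative Q has_real_derivative slowness Q x) (at x)"
proof -
  let ?S = "{x - 1..x + 1}"
  have "((\<lambda>u. integral {x - 1..u} (slowness Q)) has_vector_derivative slowness Q x) (at x within ?S - {})"
    using assms by (intro integral_has_vector_derivative_continuous_at slowness_integrable)
      (auto intro: continuous_at_imp_continuous_at_within)
  then have "((\<lambda>u. cumulative Q (x - 1) + travel Q (x - 1) u) has_real_derivative slowness Q x) (at x within ?S)"
    unfolding travel_def has_real_derivative_iff_has_vector_derivative[symmetric]
    by (auto intro: derivative_eq_intros)
  then have "(cumulative Q has_real_derivative slowness Q x) (at x within ?S)"
    by (rule has_field_derivative_transform_within[of _ _ _ _ 1])
       (use travel_eq_cumulative[OF assms(1)] in auto)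
  then show ?thesis
    by (simp add: at_within_Icc_at)
qed

lemma slowness_isCont:
  assumes "admissible Q" "continuous_on UNIV Q" "x \<noteq> 0"
  shows "isCont (slowness Q) x"
proof -
  have FQ: "continuous_on UNIV (\<lambda>z. F (Q z))"
    using assms(1) unfolding admissible_def
    by (intro continuous_on_compose2[OF F_cont assms(2)]) auto
  have "continuous_on {..<0} (slowness Q)"
    using continuous_on_subset[OF FQ, of "{..<0}"] Vm_pos
    by (subst continuous_on_cong[of "{..<0}" "{..<0}" _ "\<lambda>z. F (Q z) / Vm"])
       (auto simp: slowness_def intro!: continuous_intros)
  moreover have "continuous_on {0<..} (slowness Q)"
    using continuous_on_subset[OF FQ, of "{0<..}"] Vp_pos
    by (subst continuous_on_cong[of "{0<..}" "{0<..}" _ "\<lambda>z. F (Q z) / Vp"])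
       (auto simp: slowness_def intro!: continuous_intros)
  ultimately show ?thesis
    using assms(3) continuous_on_eq_continuous_at[of "{..<0::real}" "slowness Q"]
      continuous_on_eq_continuous_at[of "{0<..}" "slowness Q"]
    by (cases "x < 0") auto
qed

text \<open>Implicit differentiation of
  \<open>cumulative Q (leader l Q z) = cumulative Q z + T\<close> with Caratheodory slopes. The
  slope function at the leader never vanishes, because \<open>cumulative Q\<close> is strictly
  increasing with positive derivative there, so one may divide by it.\<close>

lemma sol_leader_deriv:
  assumes "sol_on UNIV Q" "x \<noteq> 0" "leader l Q x \<noteq> 0"
  shows "(leader l Q has_real_derivative slowness Q x / slowness Q (leader l Q x)) (at x)"
proof -
  let ?y = "leader l Q" and ?A = "cumulative Q"
  have Q: "admissible Q" using assms unfolding sol_on_def by auto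
  have contQ: "continuous_on UNIV Q" by (rule sol_continuous[OF assms(1)])
  have eq: "?A (?y z) = ?A z + T" for z
    using travel_eq_cumulative[OF Q, of z "?y z"] leader_bounds(3)[OF Q, of z] assms(1)
    unfolding sol_on_def by auto
  obtain g where g: "\<And>z. ?A z - ?A x = g z * (z - x)" "isCont g x" "g x = slowness Q x"
    using cumulative_deriv[OF Q slowness_isCont[OF Q contQ assms(2)]] unfolding CARAT_DERIV by blast
  obtain h where h: "\<And>z. ?A z - ?A (?y x) = h z * (z - ?y x)" "isCont h (?y x)"
      "h (?y x) = slowness Q (?y x)"
    using cumulative_deriv[OF Q slowness_isCont[OF Q contQ assms(3)]] unfolding CARAT_DERIV by blast
  have h_nz: "h z \<noteq> 0" for z
    using h(1)[of z] h(3) slowness_bounds(3)[OF Q, of "?y x"] cumulative_strict_mono[OF Q, of z "?y x"]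
      cumulative_strict_mono[OF Q, of "?y x" z] by (cases z "?y x" rule: linorder_cases) auto
  have isCont_y: "isCont ?y x"
    using leader_continuous[OF assms(1)] by (simp add: continuous_on_eq_continuous_at)
  have "?y z - ?y x = g z / h (?y z) * (z - x)" for z
    using g(1)[of z] h(1)[of "?y z"] eq[of z] eq[of x] h_nz[of "?y z"] by (simp add: field_simps)
  moreover have "isCont (\<lambda>z. g z / h (?y z)) x"
    using g(2) h(2) isCont_y h_nz by (intro isCont_divide isCont_o2[of x ?y h]) auto
  ultimately show ?thesis
    unfolding CARAT_DERIV using g(3) h(3) by (intro exI[of _ "\<lambda>z. g z / h (?y z)"]) auto
qed

lemma ftl_rhs_eq:
  assumes "admissible Q" "x \<noteq> 0" "leader l Q x \<noteq> 0"
  shows "ftl_rhs l (\<lambda>u. 1 / F u) Vm Vp Q x =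
    (Q x)\<^sup>2 / l * (1 - slowness Q x / slowness Q (leader l Q x))"
proof -
  have "0 < F (Q x)" "0 < F (Q (leader l Q x))"
    using F_pos admissibleD[OF assms(1)] by auto
  then show ?thesis
    using assms(2,3) leader_bounds(3)[OF assms(1), of x] Vm_pos Vp_pos l_pos
    unfolding ftl_rhs_def slowness_def by (auto simp: field_simps)
qed

lemma sol_imp_ftl_solution:
  assumes "sol_on UNIV Q"
  shows "ftl_solution l (\<lambda>u. 1 / F u) Vm Vp Q"
  unfolding ftl_solution_def
proof (intro conjI allI impI)
  have Q: "admissible Q" using assms unfolding sol_on_def by auto
  show "continuous_on UNIV Q" by (rule sol_continuous[OF assms])
  fix x assume x: "x \<noteq> 0 \<and> leader l Q x \<noteq> 0"
  let ?y = "leader l Q"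
  have Q_eq: "l / (?y z - z) = Q z" and y_gt: "z < ?y z" for z
    using admissibleD(4)[OF Q, of z] l_pos leader_bounds(3)[OF Q, of z] by (simp_all add: leader_def)
  have "((\<lambda>z. l / (?y z - z)) has_real_derivative
      - (l * (slowness Q x / slowness Q (?y x) - 1)) / (?y x - x)\<^sup>2) (at x)"
    using sol_leader_deriv[OF assms] x y_gt[of x]
    by (auto intro!: derivative_eq_intros simp: power2_eq_square)
  moreover have "- (l * (s - 1)) / (?y x - x)\<^sup>2 = (Q x)\<^sup>2 / l * (1 - s)" for s
  proof -
    define d where "d = ?y x - x"
    have "0 < d" "Q x = l / d" using y_gt[of x] Q_eq[of x] by (auto simp: d_def)
    then show ?thesis
      unfolding d_def[symmetric] \<open>Q x = l / d\<close> using l_pos by (simp add: field_simps power2_eq_square)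
  qed
  ultimately have "(Q has_real_derivative ftl_rhs l (\<lambda>u. 1 / F u) Vm Vp Q x) (at x)"
    using ftl_rhs_eq[OF Q] x Q_eq by simp
  then show "(Q has_real_derivative ftl_rhs l (\<lambda>u. 1 / F u) Vm Vp Q x) (at_left x)"
    by (rule has_field_derivative_at_within)
qed

lemma limit_in_range:
  assumes "admissible Q" "(Q \<longlongrightarrow> c) G" "G \<noteq> bot"
  shows "a \<le> c" "c \<le> b"
  by (rule tendsto_lowerbound[OF assms(2) _ assms(3)] tendsto_upperbound[OF assms(2) _ assms(3)],
      simp add: admissibleD(1,2)[OF assms(1)])+

lemma F_tendsto:
  assumes "admissible Q" "(Q \<longlongrightarrow> c) G" "G \<noteq> bot"
  shows "((\<lambda>z. F (Q z)) \<longlongrightarrow> F c) G"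
  by (rule continuous_on_tendsto_compose[OF F_cont assms(2)])
     (simp_all add: limit_in_range[OF assms] admissibleD(1,2)[OF assms(1)])

lemma travel_between:
  assumes "admissible Q"
  shows "slowness Q x * (l / Q x) \<le> travel Q x (leader l Q x)"
    and "travel Q x (leader l Q x) \<le> slowness Q (leader l Q x) * (l / Q x)"
  using travel_end_bounds[OF assms, of x "leader l Q x"] leader_bounds(3)[OF assms, of x]
  by (simp_all add: leader_def)

lemma travel_leader_at_bot:
  assumes Q: "admissible Q" and c: "(Q \<longlongrightarrow> c) at_bot"
  shows "((\<lambda>x. travel Q x (leader l Q x)) \<longlongrightarrow> F c / Vm * (l / c)) at_bot"
proof (rule tendsto_sandwich)
  have c_pos: "0 < c" using limit_in_range[OF assms] a_pos by simp
  have y: "filterlim (leader l Q) at_bot at_bot"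
    unfolding filterlim_at_bot
  proof
    fix Z
    have "leader l Q x \<le> Z" if "x \<le> Z - l / a" for x
      using leader_bounds(2)[OF Q, of x] that by simp
    then show "\<forall>\<^sub>F x in at_bot. leader l Q x \<le> Z"
      unfolding eventually_at_bot_linorder by blast
  qed
  show "((\<lambda>x. F (Q x) / Vm * (l / Q x)) \<longlongrightarrow> F c / Vm * (l / c)) at_bot"
    using c_pos Vm_pos by (intro tendsto_intros F_tendsto[OF Q c] c) auto
  show "((\<lambda>x. F (Q (leader l Q x)) / Vm * (l / Q x)) \<longlongrightarrow> F c / Vm * (l / c)) at_bot"
    using c_pos Vm_pos by (intro tendsto_intros filterlim_compose[OF F_tendsto[OF Q c] y] c) auto
  have neg: "x < 0 \<and> leader l Q x < 0" if "x \<le> - l / a - 1" for x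
    using leader_bounds(2,3)[OF Q, of x] that by simp
  have ev: "\<forall>\<^sub>F x in at_bot. x < 0 \<and> leader l Q x < 0"
    using neg unfolding eventually_at_bot_linorder by blast
  show "\<forall>\<^sub>F x in at_bot. F (Q x) / Vm * (l / Q x) \<le> travel Q x (leader l Q x)"
    using ev
  proof eventually_elim
    case (elim x)
    then show ?case using travel_between(1)[OF Q, of x] by (simp add: slowness_def)
  qed
  show "\<forall>\<^sub>F x in at_bot. travel Q x (leader l Q x) \<le> F (Q (leader l Q x)) / Vm * (l / Q x)"
    using ev
  proof eventually_elim
    case (elim x)
    then show ?case using travel_between(2)[OF Q, of x] by (simp add: slowness_def)
  qed
qed

lemma travel_leader_at_top:
  assumes Q: "admissible Q" and c: "(Q \<longlongrightarrow> c) at_top"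
  shows "((\<lambda>x. travel Q x (leader l Q x)) \<longlongrightarrow> F c / Vp * (l / c)) at_top"
proof (rule tendsto_sandwich)
  have c_pos: "0 < c" using limit_in_range[OF assms] a_pos by simp
  have y: "filterlim (leader l Q) at_top at_top"
    by (rule filterlim_at_top_mono[OF filterlim_ident])
       (auto intro!: always_eventually less_imp_le leader_bounds(3)[OF Q])
  show "((\<lambda>x. F (Q x) / Vp * (l / Q x)) \<longlongrightarrow> F c / Vp * (l / c)) at_top"
    using c_pos Vp_pos by (intro tendsto_intros F_tendsto[OF Q c] c) auto
  show "((\<lambda>x. F (Q (leader l Q x)) / Vp * (l / Q x)) \<longlongrightarrow> F c / Vp * (l / c)) at_top"
    using c_pos Vp_pos by (intro tendsto_intros filterlim_compose[OF F_tendsto[OF Q c] y] c) auto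
  have ev: "\<forall>\<^sub>F x in at_top. 0 < x \<and> 0 < leader l Q x"
    using eventually_gt_at_top[of 0]
    by eventually_elim (use leader_bounds(3)[OF Q] less_trans in blast)
  show "\<forall>\<^sub>F x in at_top. F (Q x) / Vp * (l / Q x) \<le> travel Q x (leader l Q x)"
    using ev
  proof eventually_elim
    case (elim x)
    then show ?case using travel_between(1)[OF Q, of x] by (simp add: slowness_def)
  qed
  show "\<forall>\<^sub>F x in at_top. travel Q x (leader l Q x) \<le> F (Q (leader l Q x)) / Vp * (l / Q x)"
    using ev
  proof eventually_elim
    case (elim x)
    then show ?case using travel_between(2)[OF Q, of x] by (simp add: slowness_def)
  qed
qed

lemma equilibrium_a: "F a / Vm * (l / a) = T"
  using T_a Vm_pos a_pos by (simp add: field_simps)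

lemma equilibrium_b: "F b / Vp * (l / b) = T"
  using T_b Vp_pos b_pos by (simp add: field_simps)

text \<open>The time \<tau> to the leader has left derivative 0 except where the car or its leader
  is at 0. The set \<open>Z\<close> of cars with leader at 0 is not known in advance to be a single
  point, but \<tau> is constant on either side of it, with value \<open>T\<close> by the two limits.
  The first and the last car of \<open>Z\<close> thus need the same time to reach the origin, and so
  coincide.\<close>

lemma ftl_solution_imp_sol:
  assumes Q: "admissible Q" and ftl: "ftl_solution l (\<lambda>u. 1 / F u) Vm Vp Q"
    and lim_a: "(Q \<longlongrightarrow> a) at_bot" and lim_b: "(Q \<longlongrightarrow> b) at_top"
  shows "sol_on UNIV Q"
proof -
  let ?y = "leader l Q"
  define \<tau> where "\<tau> x = travel Q x (?y x)" for x
  have contQ: "continuous_on UNIV Q" using ftl unfolding ftl_solution_def by auto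
  have cont_y: "continuous_on UNIV ?y"
    unfolding leader_def using admissibleD(4)[OF Q]
    by (intro continuous_intros contQ) (simp add: order_less_imp_not_eq2)
  have \<tau>_eq: "\<tau> x = cumulative Q (?y x) - cumulative Q x" for x
    using travel_eq_cumulative[OF Q, of x "?y x"] leader_bounds(3)[OF Q, of x] by (simp add: \<tau>_def)
  have cont_\<tau>: "continuous_on S \<tau>" for S
  proof -
    have "continuous_on UNIV (\<lambda>x. cumulative Q (?y x) - cumulative Q x)"
      by (intro continuous_on_diff cumulative_continuous[OF Q]
          continuous_on_compose2[OF cumulative_continuous[OF Q] cont_y]) auto
    then show ?thesis using \<tau>_eq continuous_on_subset by (metis (no_types, lifting) continuous_on_cong subset_UNIV)
  qed
  have deriv: "(\<tau> has_real_derivative 0) (at_left x)" if x: "x \<noteq> 0" "?y x \<noteq> 0" for x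
  proof -
    let ?s = "slowness Q x / slowness Q (?y x)"
    have "(Q has_real_derivative (Q x)\<^sup>2 / l * (1 - ?s)) (at_left x)"
      using ftl x ftl_rhs_eq[OF Q x] unfolding ftl_solution_def by auto
    then have "((\<lambda>x. x + l / Q x) has_real_derivative 1 + (- (l * ((Q x)\<^sup>2 / l * (1 - ?s))) / (Q x)\<^sup>2)) (at_left x)"
      using admissibleD(4)[OF Q, of x]
      by (auto intro!: derivative_eq_intros simp: power2_eq_square)
    moreover have "1 + (- (l * ((Q x)\<^sup>2 / l * (1 - ?s))) / (Q x)\<^sup>2) = ?s"
      using admissibleD(4)[OF Q, of x] l_pos by (simp add: field_simps)
    ultimately have "(?y has_real_derivative ?s) (at_left x)"
      unfolding leader_def[abs_def] by simp
    then have "((\<lambda>x. cumulative Q (?y x)) has_real_derivative slowness Q (?y x) * ?s) (at_left x)"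
      using DERIV_chain' cumulative_deriv[OF Q slowness_isCont[OF Q contQ x(2)]] by blast
    from DERIV_diff[OF this has_field_derivative_at_within[OF cumulative_deriv[OF Q slowness_isCont[OF Q contQ x(1)]]]]
    have "((\<lambda>x. cumulative Q (?y x) - cumulative Q x) has_real_derivative 0) (at_left x)"
      using slowness_bounds(3)[OF Q, of "?y x"] by simp
    then show ?thesis
      unfolding \<tau>_eq[symmetric] .
  qed
  define Z where "Z = {x. ?y x = 0}"
  have Z_bounds: "- l / a \<le> x" "x < 0" if "x \<in> Z" for x
    using leader_bounds[OF Q, of x] that unfolding Z_def by auto
  have "\<exists>x\<ge>- l / a - 1. x \<le> 0 \<and> ?y x = 0"
    using leader_bounds[OF Q, of 0] leader_bounds[OF Q, of "- l / a - 1"] l_pos a_pos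
    by (intro IVT') (auto intro: continuous_on_subset[OF cont_y])
  then have Z_ne: "Z \<noteq> {}" unfolding Z_def by auto
  have "closed Z"
    unfolding Z_def using cont_y by (intro closed_Collect_eq) auto
  moreover have bdd: "bdd_below Z" "bdd_above Z"
    by (rule bdd_belowI bdd_aboveI, erule Z_bounds, rule bdd_aboveI, rule less_imp_le, erule Z_bounds)
  ultimately have p_Z: "Inf Z \<in> Z" and q_Z: "Sup Z \<in> Z"
    using Z_ne closed_contains_Inf[of Z] closed_contains_Sup[of Z] by simp_all
  define p q where "p = Inf Z" and "q = Sup Z"
  have left_of: "\<tau> x = \<tau> p" if "x \<le> p" for x
  proof (rule eq_of_left_deriv_zero[OF that cont_\<tau>])
    fix z assume "x < z" "z < p"
    then have "z \<noteq> 0" "z \<notin> Z"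
      using Z_bounds(2)[OF p_Z] cInf_lower[OF _ bdd(1), of z] by (auto simp: p_def)
    then show "(\<tau> has_real_derivative 0) (at_left z)" using deriv by (simp add: Z_def)
  qed
  have right_of: "\<tau> x = \<tau> w" if "q \<le> x" "x \<le> w" "0 \<notin> {x<..<w}" for x w
  proof (rule eq_of_left_deriv_zero[OF that(2) cont_\<tau>])
    fix z assume "x < z" "z < w"
    then have "z \<noteq> 0" "z \<notin> Z"
      using that cSup_upper[OF _ bdd(2), of z] by (auto simp: q_def)
    then show "(\<tau> has_real_derivative 0) (at_left z)" using deriv by (simp add: Z_def)
  qed
  have q_neg: "q < 0" using Z_bounds(2)[OF q_Z] by (simp add: q_def)
  have right: "\<tau> x = \<tau> 0" if "q \<le> x" for x
    using right_of[of x 0] right_of[of 0 x] q_neg that by (cases "x \<le> 0") auto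
  have "(\<tau> \<longlongrightarrow> T) at_bot"
    using travel_leader_at_bot[OF Q lim_a] equilibrium_a by (simp add: \<tau>_def[abs_def])
  moreover have "(\<tau> \<longlongrightarrow> \<tau> p) at_bot"
    by (intro tendsto_eventually eventually_mono[OF eventually_le_at_bot[of p]] left_of)
  ultimately have \<tau>_p: "\<tau> p = T" using tendsto_unique trivial_limit_at_bot_linorder by blast
  have "(\<tau> \<longlongrightarrow> T) at_top"
    using travel_leader_at_top[OF Q lim_b] equilibrium_b by (simp add: \<tau>_def[abs_def])
  moreover have "(\<tau> \<longlongrightarrow> \<tau> 0) at_top"
    by (intro tendsto_eventually eventually_mono[OF eventually_ge_at_top[of q]] right)
  ultimately have \<tau>_0: "\<tau> 0 = T" using tendsto_unique trivial_limit_at_top_linorder by blast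
  then have "\<tau> q = T" using right[of q] by simp
  moreover have "\<tau> p = travel Q p 0" "\<tau> q = travel Q q 0"
    using p_Z q_Z unfolding \<tau>_def p_def q_def Z_def by auto
  ultimately have "cumulative Q p = cumulative Q q"
    using \<tau>_p travel_eq_cumulative[OF Q, of p 0] travel_eq_cumulative[OF Q, of q 0] q_neg
      Z_bounds(2)[OF p_Z] by (simp add: p_def[symmetric])
  then have "p = q"
    using cumulative_strict_mono[OF Q, of p q] cumulative_strict_mono[OF Q, of q p]
    by (cases p q rule: linorder_cases) auto
  then have "\<tau> x = T" for x
    using left_of[of x] right[of x] \<tau>_p \<tau>_0 by (cases "x \<le> p") auto
  then show ?thesis using Q unfolding sol_on_def \<tau>_def by auto
qed

subsection \<open>Backward uniqueness and stationary states\<close>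

text \<open>A contraction: travel times of profiles that agree beyond \<open>x0\<close> differ only
  through a stretch of length at most \<delta>, and converting the change of the leader's position
  into a change of density halves the bound on the difference. The same \<delta> serves all
  profiles, so the step can be iterated.\<close>

lemma backward_step:
  obtains \<delta> where "0 < \<delta>"
    "\<And>Q P c x0 x. \<lbrakk>sol_on {c..} Q; sol_on {c..} P; \<And>z. x0 \<le> z \<Longrightarrow> Q z = P z; c \<le> x; x0 - \<delta> \<le> x\<rbrakk>
      \<Longrightarrow> Q x = P x"
proof -
  \<comment> \<open>\<open>l / b\<close> puts the leader of every
    \<open>x \<ge> x0 - \<delta>\<close> beyond \<open>x0\<close>; the second bound makes the
    contraction factor 1/2.\<close>
  define \<delta> where "\<delta> = min (l / b) (a * T * Vp / (2 * b\<^sup>2 * M))"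
  have \<delta>_pos: "0 < \<delta>"
    using l_pos a_pos b_pos T_pos Vp_pos M_pos by (simp add: \<delta>_def)
  have \<delta>_l: "\<delta> \<le> l / b" by (simp add: \<delta>_def)
  have \<delta>_M: "M / Vp * \<delta> \<le> a * T / b\<^sup>2 / 2"
  proof -
    have "M / Vp * \<delta> \<le> M / Vp * (a * T * Vp / (2 * b\<^sup>2 * M))"
      using M_pos Vp_pos by (intro mult_left_mono) (auto simp: \<delta>_def)
    also have "\<dots> = a * T / b\<^sup>2 / 2"
      using M_pos Vp_pos by (simp add: field_simps)
    finally show ?thesis .
  qed
  have half: "Q x \<le> P x + B / 2"
    if sol: "sol_on {c..} Q" "sol_on {c..} P" and eq: "\<And>z. x0 \<le> z \<Longrightarrow> Q z = P z"
      and x: "c \<le> x" "x0 - \<delta> \<le> x" and B: "0 \<le> B"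
      and le: "\<And>z. x \<le> z \<Longrightarrow> Q z \<le> P z + B"
    for Q P c x0 x B
  proof (cases "Q x \<le> P x \<or> x0 \<le> x")
    case True
    then show ?thesis using eq[of x] B by auto
  next
    case False
    have Q: "admissible Q" and P: "admissible P"
      and tQ: "travel Q x (leader l Q x) = T" and tP: "travel P x (leader l P x) = T"
      using sol x unfolding sol_on_def by auto
    let ?yQ = "leader l Q x" and ?yP = "leader l P x"
    have pos: "0 < Q x" "0 < P x" using admissibleD Q P by auto
    have diff: "?yP - ?yQ = l * (Q x - P x) / (Q x * P x)"
      using pos by (simp add: leader_def field_simps)
    have y_le: "?yQ \<le> ?yP"
      using diff pos False l_pos by (simp add: zero_le_divide_iff zero_le_mult_iff algebra_simps)
    have x0: "x0 \<le> ?yQ" using leader_bounds(1)[OF Q, of x] x \<delta>_l by linarith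
    have "travel Q x0 ?yQ \<le> travel P x0 ?yQ"
      using x0 eq by (intro travel_le Q P) auto
    moreover have "travel Q x x0 \<le> travel P x x0 + M / Vp * B * (x0 - x)"
      using le B False by (intro travel_le_add Q P) auto
    ultimately have "T \<le> travel P x ?yQ + M / Vp * B * (x0 - x)"
      using travel_combine[OF Q, of x x0 ?yQ] travel_combine[OF P, of x x0 ?yQ] x0 False tQ by linarith
    then have "travel P ?yQ ?yP \<le> M / Vp * B * (x0 - x)"
      using travel_combine[OF P _ y_le, of x] leader_bounds(3)[OF Q, of x] tP by linarith
    also have "\<dots> \<le> M / Vp * B * \<delta>"
      using x B M_pos Vp_pos by (intro mult_left_mono) auto
    also have "\<dots> = M / Vp * \<delta> * B" by simp
    also have "\<dots> \<le> a * T / b\<^sup>2 / 2 * B"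
      using \<delta>_M B by (rule mult_right_mono)
    finally have up: "travel P ?yQ ?yP \<le> a * T / b\<^sup>2 / 2 * B" .
    have "Q x * P x \<le> b * b"
      using admissibleD[OF Q, of x] admissibleD[OF P, of x] by (intro mult_mono) auto
    then have "l * (Q x - P x) / b\<^sup>2 \<le> ?yP - ?yQ"
      unfolding diff power2_eq_square using pos False l_pos b_pos
      by (intro divide_left_mono) (auto intro: mult_pos_pos)
    then have "a * T / l * (l * (Q x - P x) / b\<^sup>2) \<le> a * T / l * (?yP - ?yQ)"
      using aT_pos by (intro mult_left_mono) auto
    also have "\<dots> \<le> travel P ?yQ ?yP" by (rule travel_bounds(1)[OF P y_le])
    finally have "a * T / b\<^sup>2 * (Q x - P x) \<le> a * T / b\<^sup>2 * (B / 2)"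
      using up l_pos by simp
    moreover have "0 < a * T / b\<^sup>2" using a_pos T_pos b_pos by simp
    ultimately have "Q x - P x \<le> B / 2" by (subst (asm) mult_le_cancel_left_pos)
    then show ?thesis by simp
  qed
  have "Q x = P x"
    if sol: "sol_on {c..} Q" "sol_on {c..} P" and eq: "\<And>z. x0 \<le> z \<Longrightarrow> Q z = P z"
      and x: "c \<le> x" "x0 - \<delta> \<le> x" for Q P c x0 x
  proof -
    have Q: "admissible Q" and P: "admissible P" using sol unfolding sol_on_def by auto
    have "\<forall>z. c \<le> z \<and> x0 - \<delta> \<le> z \<longrightarrow> \<bar>Q z - P z\<bar> \<le> (b - a) / 2 ^ n" for n
    proof (induction n)
      case 0
      have "\<bar>Q z - P z\<bar> \<le> b - a" for z
        using admissibleD(1,2)[OF Q, of z] admissibleD(1,2)[OF P, of z] by auto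
      then show ?case by simp
    next
      case (Suc n)
      have "\<bar>Q z - P z\<bar> \<le> (b - a) / 2 ^ n / 2" if z: "c \<le> z" "x0 - \<delta> \<le> z" for z
      proof -
        have le: "\<bar>Q w - P w\<bar> \<le> (b - a) / 2 ^ n" if "z \<le> w" for w
          using Suc.IH z that by auto
        have "Q w \<le> P w + (b - a) / 2 ^ n" "P w \<le> Q w + (b - a) / 2 ^ n" if "z \<le> w" for w
          using le[OF that] by auto
        moreover have "0 \<le> (b - a) / 2 ^ n" using a_less by simp
        ultimately have "Q z \<le> P z + (b - a) / 2 ^ n / 2" "P z \<le> Q z + (b - a) / 2 ^ n / 2"
          using half[OF sol eq z] half[OF sol(2,1) eq[symmetric] z] by blast+
        then show ?thesis by simp
      qed
      then show ?case by (simp add: mult.commute)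
    qed
    then have "Q x - P x = 0"
      using x by (intro geometric_bound_imp_zero[of _ "b - a"]) auto
    then show ?thesis by simp
  qed
  with \<delta>_pos that show thesis by blast
qed

lemma backward_unique:
  assumes sol: "sol_on {c..} Q" "sol_on {c..} P" and eq: "\<And>z. x0 \<le> z \<Longrightarrow> Q z = P z"
    and x: "c \<le> x"
  shows "Q x = P x"
proof -
  obtain \<delta> where \<delta>: "0 < \<delta>"
    "\<And>Q P c x0 x. \<lbrakk>sol_on {c..} Q; sol_on {c..} P; \<And>z. x0 \<le> z \<Longrightarrow> Q z = P z; c \<le> x; x0 - \<delta> \<le> x\<rbrakk>
      \<Longrightarrow> Q x = P x"
    using backward_step by blast
  have "\<forall>z. c \<le> z \<and> x0 - real n * \<delta> \<le> z \<longrightarrow> Q z = P z" for n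
  proof (induction n)
    case 0
    then show ?case using eq by simp
  next
    case (Suc n)
    have "Q z = P z" if z: "c \<le> z" "x0 - real (Suc n) * \<delta> \<le> z" for z
    proof (rule \<delta>(2)[OF sol _ z(1)])
      show "Q w = P w" if "max c (x0 - real n * \<delta>) \<le> w" for w
        using Suc.IH that by auto
      show "max c (x0 - real n * \<delta>) - \<delta> \<le> z"
        using z \<delta>(1) by (auto simp: algebra_simps max_def)
    qed
    then show ?case by blast
  qed
  moreover obtain n where "x0 - x < real n * \<delta>"
    using \<delta>(1) reals_Archimedean3 by blast
  then have "x0 - real n * \<delta> \<le> x" by simp
  ultimately show ?thesis using x by blast
qed

section \<open>Translations and constant states on the right half-line\<close>

lemma slowness_nonneg: "0 \<le> z \<Longrightarrow> slowness Q z = F (Q z) / Vp"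
  by (simp add: slowness_def)

text \<open>Right of 0 the slowness depends on the position only through the density, hence the
  restriction to \<open>{0..}\<close> and to shifts \<open>c \<ge> 0\<close>.\<close>

lemma translate_sol:
  assumes "sol_on {0..} P" "0 \<le> c"
  shows "sol_on {0..} (\<lambda>z. P (z + c))"
  unfolding sol_on_def
proof (intro conjI ballI)
  let ?R = "\<lambda>z. P (z + c)"
  have P: "admissible P" using assms unfolding sol_on_def by auto
  then show "admissible ?R" unfolding admissible_def by (auto simp: mono_def)
  fix x :: real assume x: "x \<in> {0..}"
  have "travel ?R x y = travel P (x + c) (y + c)" for y
  proof -
    have "travel ?R x y = integral {x..y} (slowness P \<circ> (+) c)"
      unfolding travel_def using x assms(2)
      by (intro Henstock_Kurzweil_Integration.integral_cong) (auto simp: slowness_nonneg add.commute)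
    then show ?thesis unfolding travel_def integral_shift_Icc_real by simp
  qed
  moreover have "leader l ?R x + c = leader l P (x + c)" by (simp add: leader_def)
  ultimately show "travel ?R x (leader l ?R x) = T"
    using assms x unfolding sol_on_def by simp
qed

lemma const_b_sol: "sol_on {0..} (\<lambda>_. b)"
  unfolding sol_on_def
proof (intro conjI ballI)
  show adm: "admissible (\<lambda>_. b)" unfolding admissible_def using a_less by (auto simp: mono_def)
  fix x :: real assume x: "x \<in> {0..}"
  let ?y = "leader l (\<lambda>_. b) x"
  have "travel (\<lambda>_. b) x ?y = F b / Vp * (?y - x)"
    using travel_end_bounds[OF adm, of x ?y] leader_bounds(3)[OF adm, of x] x
    by (simp add: slowness_nonneg)
  then show "travel (\<lambda>_. b) x ?y = T"
    using equilibrium_b by (simp add: leader_def)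
qed

lemma F_strict: "a \<le> u \<Longrightarrow> u < v \<Longrightarrow> v \<le> b \<Longrightarrow> F u < F v"
  using F_diff_lower[of u v] mult_pos_pos[of m "v - u"] m_pos by linarith

text \<open>As \<open>P\<close> increases, the travel time from \<open>y\<close> to its leader is at least the right-hand side of
  the hypothesis, with equality only if \<open>P\<close> is constant in between.\<close>

lemma stationary_const:
  assumes sol: "sol_on {0..} P" and y: "0 \<le> y" and slow: "T \<le> F (P y) / Vp * (l / P y)"
    and z: "y \<le> z"
  shows "P z = P y"
proof -
  have P: "admissible P" using sol unfolding sol_on_def by auto
  define d where "d = l / P y"
  have d: "0 < d" using admissibleD(4)[OF P, of y] l_pos by (simp add: d_def)
  have near: "P w = P y" if "0 \<le> x" "P x = P y" "x \<le> w" "w < x + d" for x w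
  proof (rule ccontr)
    assume "P w \<noteq> P y"
    then have lt: "P y < P w" using admissibleD(3)[OF P, of x w] that by auto
    then have "F (P y) / Vp < F (P w) / Vp"
      using F_strict[of "P y" "P w"] admissibleD[OF P] Vp_pos by (simp add: divide_strict_right_mono)
    then have "F (P y) / Vp * (x + d - w) < F (P w) / Vp * (x + d - w)"
      using that by (intro mult_strict_right_mono) auto
    also have "\<dots> \<le> travel P w (x + d)"
      using travel_end_bounds(1)[OF P, of w "x + d"] that by (simp add: slowness_nonneg)
    finally have "F (P y) / Vp * (x + d - w) < travel P w (x + d)" .
    moreover have "F (P y) / Vp * (w - x) \<le> travel P x w"
      using travel_end_bounds(1)[OF P, of x w] that by (simp add: slowness_nonneg)
    moreover have "F (P y) / Vp * (x + d - w) + F (P y) / Vp * (w - x) = F (P y) / Vp * d"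
      unfolding distrib_left[symmetric] by simp
    ultimately have "T < travel P x (x + d)"
      using travel_combine[OF P, of x w "x + d"] that slow unfolding d_def by linarith
    moreover have "travel P x (x + d) = T"
      using sol that(1) unfolding sol_on_def d_def leader_def that(2)[symmetric] by auto
    ultimately show False by simp
  qed
  \<comment> \<open>Half steps, because \<open>near\<close> leaves out the end point
    \<open>x + d\<close>.\<close>
  have "\<forall>w. y \<le> w \<and> w \<le> y + real n * (d / 2) \<longrightarrow> P w = P y" for n
  proof (induction n)
    case 0
    have "P w = P y" if "y \<le> w \<and> w \<le> y + real 0 * (d / 2)" for w
      using that by (intro arg_cong[of _ _ P]) simp
    then show ?case by (intro allI impI)
  next
    case (Suc n)
    have "P w = P y" if w: "y \<le> w" "w \<le> y + real (Suc n) * (d / 2)" for w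
    proof (cases "w \<le> y + real n * (d / 2)")
      case True
      then show ?thesis using Suc.IH w by blast
    next
      case False
      define x where "x = y + real n * (d / 2)"
      have "y \<le> x" using d by (simp add: x_def)
      moreover have "w < x + d" using w(2) d by (simp add: x_def field_simps)
      moreover have "P x = P y"
        using Suc.IH \<open>y \<le> x\<close> unfolding x_def by blast
      ultimately show ?thesis
        using False y by (intro near[of x w]) (auto simp: x_def)
    qed
    then show ?case by blast
  qed
  moreover have "0 < d / 2" using d by simp
  then obtain n where "z - y < real n * (d / 2)"
    using reals_Archimedean3 by blast
  then have "z \<le> y + real n * (d / 2)" by simp
  ultimately show ?thesis using z by blast
qed

lemma stationary_imp_b:
  assumes "sol_on {0..} P" "(P \<longlongrightarrow> b) at_top" "0 \<le> y" "T \<le> F (P y) / Vp * (l / P y)"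
  shows "P y = b"
proof -
  have "(P \<longlongrightarrow> P y) at_top"
    by (intro tendsto_eventually eventually_mono[OF eventually_ge_at_top[of y]]
        stationary_const[OF assms(1,3,4)])
  then show ?thesis using assms(2) tendsto_unique trivial_limit_at_top_linorder by blast
qed

text \<open>A profile that reaches the maximal value \<open>b\<close> keeps it by monotonicity;
  backward uniqueness then compares it with the constant solution down to 0.\<close>

lemma reaches_b_imp_b:
  assumes "sol_on {0..} P" "0 \<le> y" "P y = b" "0 \<le> z"
  shows "P z = b"
proof (rule backward_unique[OF assms(1) const_b_sol _ assms(4)])
  have P: "admissible P" using assms unfolding sol_on_def by auto
  show "P w = b" if "y \<le> w" for w
    using admissibleD(2)[OF P, of w] admissibleD(3)[OF P that] assms(3) by simp
qed

text \<open>Right of 0 the equation makes this increment comparable with the slope of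
  \<open>P\<close> at \<open>x\<close>; it is the local unit in which differences of profiles are
  measured.\<close>

definition gap :: "(real \<Rightarrow> real) \<Rightarrow> real \<Rightarrow> real" where
  "gap P x = P (leader l P x) - P x"

lemma gap_nonneg: "admissible P \<Longrightarrow> 0 \<le> gap P x"
  using admissibleD(3)[of P x "leader l P x"] leader_bounds(3)[of P x] by (simp add: gap_def)

text \<open>A vanishing gap means equal densities at \<open>x\<close> and at its leader, so
  \<open>x\<close> is stationary; then \<open>P\<close> equals \<open>b\<close> at \<open>x\<close>
  and hence on the whole right half-line.\<close>

lemma gap_pos:
  assumes sol: "sol_on {0..} P" and lim: "(P \<longlongrightarrow> b) at_top" and "P 0 < b" and x: "0 \<le> x"
  shows "0 < gap P x"
proof (rule ccontr)
  assume "\<not> 0 < gap P x"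
  have P: "admissible P" using sol unfolding sol_on_def by auto
  have "P (leader l P x) = P x"
    using \<open>\<not> 0 < gap P x\<close> gap_nonneg[OF P, of x] by (simp add: gap_def)
  moreover have "0 \<le> leader l P x" using leader_bounds(3)[OF P, of x] x by simp
  ultimately have "T \<le> F (P x) / Vp * (l / P x)"
    using travel_between(2)[OF P, of x] sol x unfolding sol_on_def by (auto simp: slowness_nonneg)
  then have "P x = b" by (rule stationary_imp_b[OF sol lim x])
  then show False using reaches_b_imp_b[OF sol x, of 0] assms(3) by simp
qed

subsection \<open>Harnack inequality and crossings\<close>

text \<open>Right of 0 the slope of \<open>P\<close> is \<open>(P x)\<^sup>2 / l\<close> times the
  increase of \<open>F\<close> up to the leader, relative to its value there. With
  \<open>m \<le> F' \<le> M\<close> this lies between \<open>growth_lo\<close> and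
  \<open>growth_hi\<close> times the gap.\<close>

definition growth_lo :: real where "growth_lo = m * a\<^sup>2 / (l * F b)"

definition growth_hi :: real where "growth_hi = M * b\<^sup>2 / (l * F a)"

lemma F_b_pos: "0 < F b"
  using F_pos[of b] a_less by simp

lemma growth_pos: "0 < growth_lo" "0 < growth_hi"
  using m_pos M_pos a_pos b_pos l_pos F_a_pos F_b_pos by (auto simp: growth_lo_def growth_hi_def)

lemma leader_increment:
  assumes "admissible P"
  shows "leader l P x2 - leader l P x1 = (x2 - x1) - l * (P x2 - P x1) / (P x1 * P x2)"
  using admissibleD(4)[OF assms, of x1] admissibleD(4)[OF assms, of x2]
  by (simp add: leader_def field_simps)

text \<open>A differential inequality in integrated form: the way from \<open>x1\<close> to
  \<open>x2\<close> and the way between their leaders take the same time, while their lengths differ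
  by a multiple of \<open>P x2 - P x1\<close>.\<close>

lemma growth_lower:
  assumes sol: "sol_on {0..} P" and x: "0 \<le> x1" "x1 \<le> x2"
  shows "growth_lo * (x2 - x1) * (P (leader l P x1) - P x2) \<le> P x2 - P x1"
proof -
  have P: "admissible P" using sol unfolding sol_on_def by auto
  note D = admissibleD[OF P]
  let ?y1 = "leader l P x1" and ?y2 = "leader l P x2"
  have y: "?y1 \<le> ?y2" "travel P ?y1 ?y2 = travel P x1 x2" "0 \<le> ?y1"
    using leader_travel[OF sol, of x1 x2] x leader_bounds(3)[OF P, of x1] by auto
  have inc: "0 \<le> P x2 - P x1" using D(3)[OF x(2)] by simp
  show ?thesis
  proof (cases "P x2 \<le> P ?y1")
    case False
    then have "growth_lo * (x2 - x1) * (P ?y1 - P x2) \<le> 0"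
      using growth_pos x by (intro mult_nonneg_nonpos) auto
    then show ?thesis using inc by simp
  next
    case True
    have "F (P ?y1) / Vp * (?y2 - ?y1) \<le> F (P x2) / Vp * (x2 - x1)"
      using travel_end_bounds(1)[OF P y(1)] travel_end_bounds(2)[OF P x(2)] y x
      by (simp add: slowness_nonneg)
    then have "F (P ?y1) * (?y2 - ?y1) \<le> F (P x2) * (x2 - x1)"
      using Vp_pos by (simp add: divide_le_cancel)
    then have "(F (P ?y1) - F (P x2)) * (x2 - x1) \<le> F (P ?y1) * (l * (P x2 - P x1) / (P x1 * P x2))"
      unfolding leader_increment[OF P] by (simp add: algebra_simps)
    also have "\<dots> \<le> F b * (l * (P x2 - P x1) / (a * a))"
    proof (rule mult_mono[OF _ divide_left_mono])
      show "a * a \<le> P x1 * P x2"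
        using D(1)[of x1] D(1)[of x2] a_pos D(4)[of x1] by (intro mult_mono) auto
      show "0 < P x1 * P x2 * (a * a)" using D a_pos by (intro mult_pos_pos) auto
      show "0 \<le> l * (P x2 - P x1) / (P x1 * P x2)"
        using D(4) inc l_pos by (intro divide_nonneg_pos mult_nonneg_nonneg mult_pos_pos) auto
    qed (use D inc l_pos F_mono[of "P ?y1" b] F_b_pos in auto)
    finally have up: "(F (P ?y1) - F (P x2)) * (x2 - x1) \<le> F b * l / (a * a) * (P x2 - P x1)"
      by simp
    have "m * (P ?y1 - P x2) * (x2 - x1) \<le> (F (P ?y1) - F (P x2)) * (x2 - x1)"
      using F_diff_lower[of "P x2" "P ?y1"] D True x by (intro mult_right_mono) auto
    with up have "m * (P ?y1 - P x2) * (x2 - x1) \<le> F b * l / (a * a) * (P x2 - P x1)" by linarith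
    then have "a * a / (F b * l) * (m * (P ?y1 - P x2) * (x2 - x1)) \<le> a * a / (F b * l) * (F b * l / (a * a) * (P x2 - P x1))"
      using F_b_pos l_pos by (intro mult_left_mono) auto
    also have "\<dots> = P x2 - P x1" using F_b_pos l_pos a_pos by simp
    finally show ?thesis by (simp add: growth_lo_def power2_eq_square mult_ac)
  qed
qed

lemma growth_upper:
  assumes sol: "sol_on {0..} P" and x: "0 \<le> x1" "x1 \<le> x2"
  shows "P x2 - P x1 \<le> growth_hi * (x2 - x1) * (P (leader l P x2) - P x1)"
proof -
  have P: "admissible P" using sol unfolding sol_on_def by auto
  note D = admissibleD[OF P]
  let ?y1 = "leader l P x1" and ?y2 = "leader l P x2"
  have y: "?y1 \<le> ?y2" "travel P ?y1 ?y2 = travel P x1 x2" "0 \<le> ?y1"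
    using leader_travel[OF sol, of x1 x2] x leader_bounds(3)[OF P, of x1] by auto
  have inc: "0 \<le> P x2 - P x1" using D(3)[OF x(2)] by simp
  have le: "P x1 \<le> P ?y2" using leader_bounds(3)[OF P, of x2] x D(3) by simp
  have "F (P x1) / Vp * (x2 - x1) \<le> F (P ?y2) / Vp * (?y2 - ?y1)"
    using travel_end_bounds(2)[OF P y(1)] travel_end_bounds(1)[OF P x(2)] y x
    by (simp add: slowness_nonneg)
  then have "F (P x1) * (x2 - x1) \<le> F (P ?y2) * (?y2 - ?y1)"
    using Vp_pos by (simp add: divide_le_cancel)
  then have up: "F (P ?y2) * (l * (P x2 - P x1) / (P x1 * P x2)) \<le> (F (P ?y2) - F (P x1)) * (x2 - x1)"
    unfolding leader_increment[OF P] by (simp add: algebra_simps)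
  have "F a * l / (b * b) * (P x2 - P x1) = F a * (l * (P x2 - P x1) / (b * b))" by simp
  also have "\<dots> \<le> F (P ?y2) * (l * (P x2 - P x1) / (P x1 * P x2))"
  proof (rule mult_mono[OF _ divide_left_mono])
    show "P x1 * P x2 \<le> b * b"
      using D(2)[of x1] D(2)[of x2] b_pos D(4)[of x2] by (intro mult_mono) auto
    show "0 < b * b * (P x1 * P x2)" using D b_pos by (intro mult_pos_pos) auto
  qed (use D inc l_pos F_mono[of a "P ?y2"] F_a_pos F_pos[of "P ?y2"] in \<open>auto intro: less_imp_le\<close>)
  also note up
  also have "(F (P ?y2) - F (P x1)) * (x2 - x1) \<le> M * (P ?y2 - P x1) * (x2 - x1)"
    using F_diff_upper[of "P x1" "P ?y2"] D le x by (intro mult_right_mono) auto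
  finally have "b * b / (F a * l) * (F a * l / (b * b) * (P x2 - P x1))
      \<le> b * b / (F a * l) * (M * (P ?y2 - P x1) * (x2 - x1))"
    using F_a_pos l_pos by (intro mult_left_mono) auto
  moreover have "b * b / (F a * l) * (F a * l / (b * b) * (P x2 - P x1)) = P x2 - P x1"
    using F_a_pos l_pos b_pos by simp
  ultimately show ?thesis by (simp add: growth_hi_def power2_eq_square mult_ac)
qed

text \<open>The first two terms allow an increment over a distance up to \<open>step\<close> to be
  absorbed on the other side of the growth estimates; the last one keeps two steps within the
  distance to the leader.\<close>

definition step :: real where
  "step = min (1 / (2 * growth_hi)) (min (1 / growth_lo) (l / (2 * b)))"

lemma step_props: "0 < step" "2 * growth_hi * step \<le> 1" "growth_lo * step \<le> 1" "2 * step \<le> l / b"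
proof -
  show "0 < step" using growth_pos l_pos b_pos by (simp add: step_def)
  have "step \<le> 1 / (2 * growth_hi)" "step \<le> 1 / growth_lo" "step \<le> l / (2 * b)"
    by (auto simp: step_def)
  then show "2 * growth_hi * step \<le> 1" "growth_lo * step \<le> 1" "2 * step \<le> l / b"
    using growth_pos b_pos by (auto simp: field_simps)
qed

lemma gap_step:
  assumes sol: "sol_on {0..} P" and x: "0 \<le> x1" "x1 \<le> x2" "x2 \<le> x1 + step"
  shows "P x2 - P x1 \<le> 2 * growth_hi * (x2 - x1) * gap P x2"
    and "growth_lo / 2 * (x2 - x1) * gap P x1 \<le> P x2 - P x1"
    and "gap P x1 \<le> 2 * gap P x2"
proof -
  have P: "admissible P" using sol unfolding sol_on_def by auto
  define D where "D = P x2 - P x1"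
  define h where "h = x2 - x1"
  have D: "0 \<le> D" using admissibleD(3)[OF P x(2)] by (simp add: D_def)
  have h: "0 \<le> h" "h \<le> step" using x by (auto simp: h_def)
  have "growth_hi * h \<le> growth_hi * step" using growth_pos h by (intro mult_left_mono) auto
  then have "growth_hi * h \<le> 1 / 2" using step_props(2) by linarith
  then have hD: "growth_hi * h * D \<le> 1 / 2 * D" using D by (rule mult_right_mono)
  have "D \<le> growth_hi * h * (gap P x2 + D)"
    using growth_upper[OF sol x(1,2)] by (simp add: D_def h_def gap_def)
  then have "D \<le> growth_hi * h * gap P x2 + growth_hi * h * D" by (simp add: distrib_left)
  with hD have 1: "D \<le> 2 * growth_hi * h * gap P x2" by simp
  then show "P x2 - P x1 \<le> 2 * growth_hi * (x2 - x1) * gap P x2"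
    by (simp add: D_def h_def)
  have "2 * growth_hi * h \<le> 1"
    using \<open>growth_hi * h \<le> 1 / 2\<close> by simp
  then have "2 * growth_hi * h * gap P x2 \<le> 1 * gap P x2"
    using gap_nonneg[OF P] by (rule mult_right_mono)
  moreover have "gap P x1 \<le> gap P x2 + D"
    using admissibleD(3)[OF P leader_travel(1)[OF sol, of x1 x2]] x by (simp add: gap_def D_def)
  ultimately show "gap P x1 \<le> 2 * gap P x2" using 1 by simp
  have "growth_lo * h \<le> growth_lo * step" using growth_pos h by (intro mult_left_mono) auto
  then have "growth_lo * h \<le> 1" using step_props(3) by linarith
  then have "growth_lo * h * D \<le> 1 * D" using D by (rule mult_right_mono)
  moreover have "growth_lo * h * (gap P x1 - D) \<le> D"
    using growth_lower[OF sol x(1,2)] by (simp add: D_def h_def gap_def)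
  ultimately have "growth_lo / 2 * h * gap P x1 \<le> D" by (simp add: right_diff_distrib)
  then show "growth_lo / 2 * (x2 - x1) * gap P x1 \<le> P x2 - P x1"
    by (simp add: D_def h_def)
qed

text \<open>The gap at \<open>x1\<close> is the increment of \<open>P\<close> over the whole interval up to the leader, hence
  it also controls the gap at later points.\<close>

lemma gap_step_forward:
  assumes sol: "sol_on {0..} P" and x: "0 \<le> x1" "x1 \<le> x2" "x2 \<le> x1 + step"
  shows "growth_lo / 2 * step * gap P x2 \<le> gap P x1"
proof -
  have P: "admissible P" using sol unfolding sol_on_def by auto
  have "growth_lo / 2 * step * gap P x2 \<le> P (x2 + step) - P x2"
    using gap_step(2)[OF sol, of x2 "x2 + step"] x step_props(1) by simp
  moreover have "P (x2 + step) \<le> P (leader l P x1)"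
    using x step_props(4) leader_bounds(1)[OF P, of x1] by (intro admissibleD(3)[OF P]) linarith
  ultimately show ?thesis using admissibleD(3)[OF P x(2)] by (simp add: gap_def)
qed

text \<open>A chain of links of length at most \<open>step\<close>; their number depends only on
  \<open>W\<close>, so the constant is uniform over all solutions.\<close>

lemma gap_comparable:
  obtains C where "1 \<le> C"
    "\<And>P x1 x2. \<lbrakk>sol_on {0..} P; 0 \<le> x1; x1 \<le> x2; x2 \<le> x1 + W\<rbrakk>
      \<Longrightarrow> gap P x1 \<le> C * gap P x2 \<and> gap P x2 \<le> C * gap P x1"
proof -
  define C where "C = 2 + 2 / (growth_lo * step)"
  have C: "2 \<le> C" "1 \<le> C * (growth_lo / 2 * step)"
    using growth_pos step_props(1) by (auto simp: C_def field_simps)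
  have one: "gap P x1 \<le> C * gap P x2 \<and> gap P x2 \<le> C * gap P x1"
    if sol: "sol_on {0..} P" and x: "0 \<le> x1" "x1 \<le> x2" "x2 \<le> x1 + step" for P x1 x2
  proof
    have P: "admissible P" using sol unfolding sol_on_def by auto
    have "gap P x1 \<le> 2 * gap P x2" by (rule gap_step(3)[OF sol x])
    also have "\<dots> \<le> C * gap P x2" using C(1) gap_nonneg[OF P] by (rule mult_right_mono)
    finally show "gap P x1 \<le> C * gap P x2" .
    have "1 * gap P x2 \<le> C * (growth_lo / 2 * step) * gap P x2"
      using C(2) gap_nonneg[OF P] by (rule mult_right_mono)
    also have "\<dots> = C * (growth_lo / 2 * step * gap P x2)" by simp
    also have "\<dots> \<le> C * gap P x1"
      using gap_step_forward[OF sol x] C(1) by (intro mult_left_mono) auto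
    finally show "gap P x2 \<le> C * gap P x1" by simp
  qed
  have many: "gap P x1 \<le> C ^ n * gap P x2 \<and> gap P x2 \<le> C ^ n * gap P x1"
    if sol: "sol_on {0..} P" and x: "0 \<le> x1" "x1 \<le> x2" "x2 \<le> x1 + real n * step" for P x1 x2 n
    using x
  proof (induction n arbitrary: x2)
    case 0
    then have "x1 = x2" by simp
    then show ?case by simp
  next
    case (Suc n)
    define z where "z = max x1 (x2 - step)"
    have "x1 \<le> z" "z \<le> x1 + real n * step"
      using Suc.prems step_props(1) by (auto simp: z_def algebra_simps)
    then have IH: "gap P x1 \<le> C ^ n * gap P z" "gap P z \<le> C ^ n * gap P x1"
      using Suc.IH[of z] Suc.prems(1) by auto
    have "z \<le> x2" "x2 \<le> z + step" "0 \<le> z"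
      using Suc.prems step_props(1) by (auto simp: z_def)
    then have zx: "gap P z \<le> C * gap P x2" "gap P x2 \<le> C * gap P z"
      using one[OF sol, of z x2] by auto
    have "C ^ n * gap P z \<le> C ^ n * (C * gap P x2)" "C * gap P z \<le> C * (C ^ n * gap P x1)"
      using zx IH C(1) by (auto intro!: mult_left_mono)
    then show ?case using IH zx by (auto simp: mult_ac)
  qed
  obtain n where "W / step < real n" using reals_Archimedean2 by blast
  then have "W \<le> real n * step" using step_props(1) by (simp add: field_simps)
  then have "gap P x1 \<le> C ^ n * gap P x2 \<and> gap P x2 \<le> C ^ n * gap P x1"
    if "sol_on {0..} P" "0 \<le> x1" "x1 \<le> x2" "x2 \<le> x1 + W" for P x1 x2
    using many[of P x1 x2 n] that by linarith
  moreover have "1 \<le> C ^ n" using C(1) by simp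
  ultimately show thesis using that by blast
qed

text \<open>Increments anywhere in the window are compared with the gap at its left end. This gives
  the sliding argument one unit for both near contact and separation.\<close>

lemma harnack:
  obtains A where "1 \<le> A"
    "\<And>P x x1 x2. \<lbrakk>sol_on {0..} P; 0 \<le> x; x \<le> x1; x1 \<le> x2; x2 \<le> x + W; x2 \<le> x1 + step\<rbrakk>
      \<Longrightarrow> (x2 - x1) * gap P x \<le> A * (P x2 - P x1) \<and> P x2 - P x1 \<le> A * (x2 - x1) * gap P x"
proof -
  obtain C where C: "1 \<le> C"
    "\<And>P x1 x2. \<lbrakk>sol_on {0..} P; 0 \<le> x1; x1 \<le> x2; x2 \<le> x1 + W\<rbrakk>
      \<Longrightarrow> gap P x1 \<le> C * gap P x2 \<and> gap P x2 \<le> C * gap P x1"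
    using gap_comparable[where W = W] by blast
  define A where "A = 1 + (2 * growth_hi + 2 / growth_lo) * C"
  have A: "2 * growth_hi * C \<le> A" "2 / growth_lo * C \<le> A" "1 \<le> A"
    using growth_pos C(1) by (auto simp: A_def algebra_simps)
  have "(x2 - x1) * gap P x \<le> A * (P x2 - P x1) \<and> P x2 - P x1 \<le> A * (x2 - x1) * gap P x"
    if sol: "sol_on {0..} P" and x: "0 \<le> x" "x \<le> x1" "x1 \<le> x2" "x2 \<le> x + W" "x2 \<le> x1 + step" for P x x1 x2
  proof
    have P: "admissible P" using sol unfolding sol_on_def by auto
    have "P x2 - P x1 \<le> 2 * growth_hi * (x2 - x1) * gap P x2"
      using gap_step(1)[OF sol, of x1 x2] x by simp
    also have "\<dots> \<le> 2 * growth_hi * (x2 - x1) * (C * gap P x)"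
      using C(2)[OF sol, of x x2] x growth_pos by (intro mult_left_mono) auto
    also have "\<dots> = 2 * growth_hi * C * ((x2 - x1) * gap P x)" by simp
    also have "\<dots> \<le> A * ((x2 - x1) * gap P x)"
      using A(1) x gap_nonneg[OF P] by (intro mult_right_mono) auto
    finally show "P x2 - P x1 \<le> A * (x2 - x1) * gap P x" by simp
    have "growth_lo / 2 * ((x2 - x1) * gap P x) \<le> growth_lo / 2 * ((x2 - x1) * (C * gap P x1))"
      using C(2)[OF sol, of x x1] x growth_pos by (intro mult_left_mono) auto
    also have "\<dots> = C * (growth_lo / 2 * (x2 - x1) * gap P x1)" by simp
    also have "\<dots> \<le> C * (P x2 - P x1)"
      using gap_step(2)[OF sol, of x1 x2] x C(1) by (intro mult_left_mono) auto
    finally have "2 / growth_lo * (growth_lo / 2 * ((x2 - x1) * gap P x)) \<le> 2 / growth_lo * (C * (P x2 - P x1))"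
      using growth_pos by (intro mult_left_mono) auto
    then have "(x2 - x1) * gap P x \<le> 2 / growth_lo * C * (P x2 - P x1)"
      using growth_pos by simp
    also have "\<dots> \<le> A * (P x2 - P x1)"
      using A(2) admissibleD(3)[OF P x(3)] by (intro mult_right_mono) auto
    finally show "(x2 - x1) * gap P x \<le> A * (P x2 - P x1)" .
  qed
  with A(3) that show thesis by blast
qed

text \<open>Equal travel times over a common interval leave no room for strict inequality: if
  \<open>P u < Q u\<close>, continuity of \<open>P\<close> and monotonicity of \<open>Q\<close>
  extend the separation to an interval right of \<open>u\<close>, where \<open>Q\<close> loses time
  that it cannot regain.\<close>

lemma sol_eq_of_le:
  assumes sol: "sol_on {s..} Q" "sol_on {s..} P" and eq: "leader l Q s = leader l P s"
    and le: "\<And>z. s \<le> z \<Longrightarrow> z \<le> leader l Q s \<Longrightarrow> P z \<le> Q z" and u: "s \<le> u" "u < leader l Q s"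
  shows "Q u = P u"
proof (rule ccontr)
  assume "Q u \<noteq> P u"
  have Q: "admissible Q" and P: "admissible P" using sol unfolding sol_on_def by auto
  let ?y = "leader l Q s"
  define e where "e = (Q u - P u) / 2"
  have e: "0 < e" using le[of u] u \<open>Q u \<noteq> P u\<close> by (auto simp: e_def)
  have "continuous_on {s..} P" by (rule sol_continuous[OF sol(2)])
  then obtain d where d: "0 < d" "\<And>z. s \<le> z \<Longrightarrow> dist z u < d \<Longrightarrow> dist (P z) (P u) < e"
    using u(1) e unfolding continuous_on_iff by (metis atLeast_iff)
  define w where "w = min ?y (u + d / 2)"
  have w: "u < w" "w \<le> ?y" "w \<le> u + d / 2" using u d(1) by (auto simp: w_def)
  have "travel P u w + m / Vm * e * (w - u) \<le> travel Q u w"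
  proof (rule travel_ge_add[OF Q P])
    fix z assume z: "u \<le> z" "z \<le> w"
    have "P z < P u + e"
      using d(2)[of z] z w u d(1) by (auto simp: dist_real_def)
    then show "P z + e \<le> Q z"
      using admissibleD(3)[OF Q z(1)] by (simp add: e_def field_simps)
  qed (use w e in auto)
  moreover have "travel P s u \<le> travel Q s u" "travel P w ?y \<le> travel Q w ?y"
    using le u w by (auto intro!: travel_le P Q)
  moreover have "travel Q s ?y = T"
    using sol(1) unfolding sol_on_def by simp
  moreover have "travel P s ?y = T"
    using sol(2) unfolding sol_on_def eq by simp
  moreover have "travel R s ?y = travel R s u + travel R u w + travel R w ?y" if "admissible R" for R
    using travel_combine[OF that, of s u ?y] travel_combine[OF that, of u w ?y] u w by simp
  moreover have "0 < m / Vm * e * (w - u)"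
    using m_pos Vm_pos e w by simp
  ultimately show False using P Q by fastforce
qed

lemma sol_crossing_IVT:
  assumes sol: "sol_on {s..} Q" "sol_on {s..} P" and "s \<le> u" "s \<le> z" "P u < Q u" "Q z < P z"
  obtains w where "min u z < w" "w < max u z" "Q w = P w"
proof -
  have cont: "continuous_on {min u z..max u z} (\<lambda>x. Q x - P x)"
    by (intro continuous_on_diff continuous_on_subset[OF sol_continuous[OF sol(1)]]
        continuous_on_subset[OF sol_continuous[OF sol(2)]]) (use assms in auto)
  have "\<exists>w\<ge>min u z. w \<le> max u z \<and> Q w - P w = 0"
  proof (cases "u \<le> z")
    case True
    then show ?thesis using cont assms by (intro IVT2') (auto simp: min_def max_def)
  next
    case False
    then show ?thesis using cont assms by (intro IVT') (auto simp: min_def max_def)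
  qed
  then obtain w where w: "min u z \<le> w" "w \<le> max u z" "Q w - P w = 0" by auto
  moreover have "w \<noteq> u" "w \<noteq> z" using w assms by auto
  ultimately show thesis using that[of w] by (auto simp: min_def max_def split: if_splits)
qed

text \<open>Equal values at \<open>s\<close> give equal leaders, so both profiles need the time
  \<open>T\<close> for the same interval. If they differ at its midpoint, one cannot stay above the
  other, and the sign change yields the crossing.\<close>

lemma next_crossing:
  assumes sol: "sol_on {s..} Q" "sol_on {s..} P" and eq: "Q s = P s"
  obtains z where "s < z" "z < leader l Q s" "Q z = P z"
proof -
  have Q: "admissible Q" and P: "admissible P" using sol unfolding sol_on_def by auto
  let ?y = "leader l Q s"
  have y: "s < ?y" "leader l P s = ?y"
    using leader_bounds(3)[OF Q, of s] eq unfolding leader_def by auto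
  define u where "u = (s + ?y) / 2"
  have u: "s < u" "u < ?y" using y by (auto simp: u_def)
  have aux: thesis
    if sol': "sol_on {s..} R" "sol_on {s..} R'" and R: "R s = R' s" "leader l R s = ?y" "leader l R' s = ?y"
      and gt: "R' u < R u" and th: "\<And>z. s < z \<Longrightarrow> z < ?y \<Longrightarrow> R z = R' z \<Longrightarrow> thesis" for R R'
  proof -
    obtain z where z: "s \<le> z" "z \<le> ?y" "R z < R' z"
      using sol_eq_of_le[OF sol', of u] R u gt by (metis less_imp_le not_le_imp_less order_less_irrefl)
    then have "z \<noteq> s" using R by auto
    obtain w where w: "min u z < w" "w < max u z" "R w = R' w"
      using sol_crossing_IVT[OF sol' less_imp_le[OF u(1)] z(1) gt z(3)] by blast
    show thesis using th[of w] w z u \<open>z \<noteq> s\<close> by (auto simp: min_def max_def split: if_splits)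
  qed
  consider "Q u = P u" | "P u < Q u" | "Q u < P u" by linarith
  then show thesis
  proof cases
    case 1
    then show ?thesis using that u by blast
  next
    case 2
    show ?thesis by (rule aux[OF sol eq refl y(2) 2 that])
  next
    case 3
    show ?thesis by (rule aux[OF sol(2,1) eq[symmetric] y(2) refl 3]) (use that in auto)
  qed
qed

text \<open>From the last crossing \<open>t\<close> up to \<open>x\<close>, the next one lies beyond
  \<open>x\<close> by maximality, and before the leader of \<open>t\<close>, which is not ahead of
  the leader of \<open>x\<close>.\<close>

lemma crossing_window:
  assumes sol: "sol_on {s..} Q" "sol_on {s..} P" and eq: "Q s = P s" and x: "s \<le> x"
  obtains z where "x < z" "z \<le> leader l Q x" "Q z = P z"
proof -
  define C where "C = {z \<in> {s..x}. Q z = P z}"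
  have "continuous_on {s..x} (\<lambda>z. Q z - P z)"
    by (intro continuous_on_diff continuous_on_subset[OF sol_continuous[OF sol(1)]]
        continuous_on_subset[OF sol_continuous[OF sol(2)]]) auto
  then have "closed ({s..x} \<inter> (\<lambda>z. Q z - P z) -` {0})"
    by (intro continuous_closed_preimage) auto
  moreover have "{s..x} \<inter> (\<lambda>z. Q z - P z) -` {0} = C" by (auto simp: C_def)
  ultimately have "closed C" by simp
  moreover have "s \<in> C" using eq x by (simp add: C_def)
  moreover have bdd: "bdd_above C" by (auto simp: C_def intro: bdd_aboveI[of _ x])
  ultimately have t: "Sup C \<in> C" using closed_contains_Sup by blast
  define t where "t = Sup C"
  have t: "s \<le> t" "t \<le> x" "Q t = P t" using t by (auto simp: t_def C_def)
  have sub: "sol_on {t..} Q" "sol_on {t..} P"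
    using sol t(1) by (auto intro: sol_on_subset)
  obtain z where z: "t < z" "z < leader l Q t" "Q z = P z"
    using next_crossing[OF sub t(3)] by blast
  have "x < z"
  proof (rule ccontr)
    assume "\<not> x < z"
    then have "z \<in> C" using z t by (simp add: C_def)
    then have "z \<le> t" unfolding t_def using bdd by (rule cSup_upper)
    then show False using z by simp
  qed
  moreover have "z \<le> leader l Q x"
    using leader_travel(1)[OF sol(1), of t x] t x z by simp
  ultimately show thesis using that z by blast
qed

subsection \<open>Profiles that cross coincide\<close>

lemma sol_strict_mono:
  assumes sol: "sol_on {0..} P" and "0 < gap P x" "0 \<le> x" "x < y"
  shows "P x < P y"
proof -
  have P: "admissible P" using sol unfolding sol_on_def by auto
  define w where "w = min y (x + step)"
  have w: "x < w" "w \<le> x + step" "w \<le> y" using assms step_props(1) by (auto simp: w_def)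
  have "0 < growth_lo / 2 * (w - x) * gap P x"
    using growth_pos w assms by (intro mult_pos_pos) auto
  also have "\<dots> \<le> P w - P x" using gap_step(2)[OF sol, of x w] w assms by simp
  finally show ?thesis using admissibleD(3)[OF P w(3)] by simp
qed

text \<open>Sliding argument: take the smallest shift \<open>c\<close> such that \<open>Q\<close> lies below \<open>P(\<cdot> + c)\<close>. If it
  were positive, the two graphs would almost touch at some \<open>x\<close>, although they are well separated
  near the crossing of \<open>Q\<close> and \<open>P\<close> between \<open>x\<close> and its leader. By the Harnack inequality this
  separation is of the order of the gap at \<open>x\<close>, which contradicts the integrated equation at \<open>x\<close>.\<close>

lemma sol_le_of_crossings:
  assumes Qs: "sol_on {0..} Q" and Ps: "sol_on {0..} P" and x0: "0 \<le> x0"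
    and cross: "\<And>x. x0 \<le> x \<Longrightarrow> \<exists>z. x < z \<and> z \<le> leader l Q x \<and> Q z = P z"
    and gap: "\<And>x. 0 \<le> x \<Longrightarrow> 0 < gap P x"
    and x: "x0 \<le> x"
  shows "Q x \<le> P x"
proof -
  have Q: "admissible Q" and P: "admissible P" using Qs Ps unfolding sol_on_def by auto
  have contP: "continuous_on {0..} P" by (rule sol_continuous[OF Ps])
  define S where "S = {c. 0 \<le> c \<and> (\<forall>x\<ge>x0. Q x \<le> P (x + c))}"
  have contPx: "continuous_on {0..} (\<lambda>c. P (x + c))" if "x0 \<le> x" for x
    by (rule continuous_on_compose2[OF contP]) (use that x0 in \<open>auto intro!: continuous_intros\<close>)
  have "closed ({0..} \<inter> (\<lambda>c. P (x + c)) -` {Q x..})" if "x0 \<le> x" for x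
    using contPx[OF that] by (intro continuous_closed_preimage) auto
  then have "closed (\<Inter>x\<in>{x0..}. {0..} \<inter> (\<lambda>c. P (x + c)) -` {Q x..})"
    by (intro closed_INT) auto
  moreover have "(\<Inter>x\<in>{x0..}. {0..} \<inter> (\<lambda>c. P (x + c)) -` {Q x..}) = S"
    by (auto simp: S_def)
  ultimately have "closed S" by simp
  \<comment> \<open>The crossing within \<open>l / a\<close> after \<open>x\<close> already bounds
    \<open>Q x\<close> by \<open>P (x + l / a)\<close>; thus a least shift exists.\<close>
  have la: "l / a \<in> S"
    unfolding S_def
  proof (intro CollectI conjI allI impI)
    fix x assume "x0 \<le> x"
    then obtain z where z: "x < z" "z \<le> leader l Q x" "Q z = P z" using cross by blast
    have "Q x \<le> Q z" by (rule admissibleD(3)[OF Q less_imp_le[OF z(1)]])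
    also have "\<dots> \<le> P (x + l / a)"
      using z leader_bounds(2)[OF Q, of x] admissibleD(3)[OF P, of z] by simp
    finally show "Q x \<le> P (x + l / a)" .
  qed (use l_pos a_pos in auto)
  have bdd: "bdd_below S" by (auto simp: S_def intro: bdd_belowI[of _ 0])
  define c0 where "c0 = Inf S"
  have c0_S: "c0 \<in> S" using closed_contains_Inf[of S] la bdd \<open>closed S\<close> unfolding c0_def by blast
  have c0_le: "c0 \<le> l / a" unfolding c0_def using la bdd by (rule cInf_lower)
  have c0_min: "c \<notin> S" if "c < c0" for c
    using cInf_lower[OF _ bdd, of c] that unfolding c0_def by auto
  have "\<not> 0 < c0"
  proof
    assume pos: "0 < c0"
    obtain A where A: "1 \<le> A"
      "\<And>P x x1 x2. \<lbrakk>sol_on {0..} P; 0 \<le> x; x \<le> x1; x1 \<le> x2; x2 \<le> x + 2 * (l / a); x2 \<le> x1 + step\<rbrakk>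
        \<Longrightarrow> (x2 - x1) * gap P x \<le> A * (P x2 - P x1) \<and> P x2 - P x1 \<le> A * (x2 - x1) * gap P x"
      using harnack[where W = "2 * (l / a)"] by blast
    \<comment> \<open>\<open>g\<close> is the part of the shift spent on the separation
      \<open>f\<close> near the crossing. Per unit of \<open>gap P x\<close>, \<kappa> bounds from
      below the time by which the shifted profile is slower there, and \<open>N * \<eta>\<close>
      bounds from above what near contact elsewhere can make up; \<eta> is chosen last to keep the
      latter smaller.\<close>
    define g where "g = min (c0 / 4) step"
    have g: "0 < g" "g \<le> c0 / 4" "g \<le> step" using pos step_props(1) by (auto simp: g_def)
    define \<kappa> where "\<kappa> = m / Vm * (g / A) * (c0 / 4)"
    define N where "N = M / Vp * A * (l / a)"
    have \<kappa>: "0 < \<kappa>" using m_pos Vm_pos g A(1) pos by (simp add: \<kappa>_def)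
    have N: "0 < N" using M_pos Vp_pos A(1) l_pos a_pos by (simp add: N_def)
    define \<eta> where "\<eta> = min step (min (c0 / 2) (\<kappa> / (2 * N)))"
    have \<eta>: "0 < \<eta>" "\<eta> \<le> step" "\<eta> \<le> c0 / 2" "\<eta> \<le> \<kappa> / (2 * N)"
      using pos step_props(1) \<kappa> N by (auto simp: \<eta>_def)
    have small: "N * \<eta> < \<kappa>"
      using \<eta>(4) N \<kappa> by (simp add: field_simps)
    have "c0 - \<eta> \<notin> S" by (rule c0_min) (use \<eta> in simp)
    moreover have "0 \<le> c0 - \<eta>" using \<eta> pos by simp
    ultimately obtain x where x: "x0 \<le> x" "P (x + (c0 - \<eta>)) < Q x"
      unfolding S_def by (auto simp: not_le)
    have "\<exists>c\<ge>c0 - \<eta>. c \<le> c0 \<and> P (x + c) = Q x"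
    proof (rule IVT')
      show "Q x \<le> P (x + c0)" using c0_S x unfolding S_def by auto
      show "continuous_on {c0 - \<eta>..c0} (\<lambda>c. P (x + c))"
        by (rule continuous_on_subset[OF contPx[OF x(1)]]) (use \<eta> pos in auto)
    qed (use x \<eta> in auto)
    \<comment> \<open>Contact at the shift \<open>c0\<close> may happen only at infinity. A slightly
      smaller shift has exact contact at \<open>x\<close>, where both profiles then have the same
      leader; the price is the error \<open>e\<close>, controlled by \<eta>.\<close>
    then obtain c where c: "c0 - \<eta> \<le> c" "c \<le> c0" "P (x + c) = Q x" by blast
    have c_ge: "c0 / 2 \<le> c" using c \<eta> by simp
    obtain z where z: "x < z" "z \<le> leader l Q x" "Q z = P z" using cross x by blast
    have xz: "0 \<le> x" "0 \<le> z" using x x0 z by auto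
    have "x + c \<le> z"
    proof (rule ccontr)
      assume "\<not> x + c \<le> z"
      then have "P z < P (x + c)" using sol_strict_mono[OF Ps gap[OF xz(2)] xz(2)] by simp
      also have "\<dots> \<le> P z" using c z admissibleD(3)[OF Q, of x z] by simp
      finally show False by simp
    qed
    let ?y = "leader l Q x"
    define R where "R = (\<lambda>z. P (z + c))"
    have Rs: "sol_on {0..} R" unfolding R_def using c_ge pos by (intro translate_sol[OF Ps]) simp
    then have R: "admissible R" unfolding sol_on_def by auto
    have Rx: "leader l R x = ?y" using c(3) by (simp add: leader_def R_def)
    have y: "?y \<le> x + l / a" using leader_bounds(2)[OF Q] .
    define e where "e = A * \<eta> * gap P x"
    have e: "0 \<le> e" unfolding e_def using A(1) \<eta> gap[OF xz(1)] by simp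
    have near: "Q w \<le> R w + e" if "x \<le> w" "w \<le> ?y" for w
    proof -
      have "Q w \<le> P (w + c0)" using c0_S x that unfolding S_def by auto
      moreover have "P (w + c0) - P (w + c) \<le> A * ((w + c0) - (w + c)) * gap P x"
        using A(2)[OF Ps xz(1), of "w + c" "w + c0"] c that y c_ge pos c0_le \<eta> by simp
      moreover have "A * ((w + c0) - (w + c)) * gap P x \<le> e"
        unfolding e_def using c A(1) gap[OF xz(1)] by (intro mult_right_mono mult_left_mono) auto
      ultimately show ?thesis by (simp add: R_def)
    qed
    define u where "u = z - (c - g)"
    have u: "x \<le> u" "u \<le> z" "c0 / 4 \<le> z - u"
      using \<open>x + c \<le> z\<close> g c_ge by (auto simp: u_def)
    define f where "f = g * gap P x / A"
    have f: "0 \<le> f" unfolding f_def using g A(1) gap[OF xz(1)] by simp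
    have far: "Q w + f \<le> R w" if "u \<le> w" "w \<le> z" for w
    proof -
      have "g * gap P x \<le> A * (P (z + g) - P z)"
        using A(2)[OF Ps xz(1), of z "z + g"] z y g c0_le pos by simp
      then have "f \<le> P (z + g) - P z" unfolding f_def using A(1) by (simp add: field_simps)
      moreover have "P (z + g) \<le> P (w + c)"
        using that by (intro admissibleD(3)[OF P]) (simp add: u_def)
      moreover have "Q w \<le> P z" using admissibleD(3)[OF Q that(2)] z by simp
      ultimately show ?thesis by (simp add: R_def)
    qed
    have "travel Q x u \<le> travel R x u + M / Vp * e * (u - x)"
      using u z near e by (intro travel_le_add Q R) auto
    moreover have "travel Q z ?y \<le> travel R z ?y + M / Vp * e * (?y - z)"
      using u z near e by (intro travel_le_add Q R) auto
    moreover have "travel Q u z + m / Vm * f * (z - u) \<le> travel R u z"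
      using u far f by (intro travel_ge_add Q R) auto
    moreover have "travel Q x ?y = T" using Qs xz unfolding sol_on_def by simp
    moreover have "travel R x ?y = T" using Rs xz unfolding sol_on_def Rx[symmetric] by simp
    ultimately have "m / Vm * f * (z - u) \<le> M / Vp * e * (u - x) + M / Vp * e * (?y - z)"
      using travel_combine[OF Q u(1), of ?y] travel_combine[OF R u(1), of ?y]
        travel_combine[OF Q u(2) z(2)] travel_combine[OF R u(2) z(2)] u z by linarith
    also have "\<dots> = M / Vp * e * ((u - x) + (?y - z))" by (simp add: distrib_left)
    also have "\<dots> \<le> M / Vp * e * (l / a)"
      using u y e M_pos Vp_pos by (intro mult_left_mono) auto
    also have "\<dots> = N * \<eta> * gap P x" by (simp add: e_def N_def)
    also have "\<dots> < \<kappa> * gap P x" using small gap[OF xz(1)] by (rule mult_strict_right_mono)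
    also have "\<dots> = m / Vm * f * (c0 / 4)" by (simp add: \<kappa>_def f_def)
    also have "\<dots> \<le> m / Vm * f * (z - u)"
      using u f m_pos Vm_pos by (intro mult_left_mono) auto
    finally show False by simp
  qed
  moreover have "0 \<le> c0" using c0_S by (simp add: S_def)
  ultimately have "c0 = 0" by simp
  then show ?thesis using c0_S x by (auto simp: S_def)
qed

text \<open>If one profile has the value \<open>b\<close> at 0, it is constant to the right and a
  crossing passes this on to the other. Otherwise all gaps right of 0 are positive and sliding works
  in both directions.\<close>

lemma sol_unique_of_crossing:
  assumes Qs: "sol_on UNIV Q" and Ps: "sol_on UNIV P"
    and limQ: "(Q \<longlongrightarrow> b) at_top" and limP: "(P \<longlongrightarrow> b) at_top" and eq: "Q s = P s"
  shows "Q = P"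
proof -
  have Q: "admissible Q" and P: "admissible P" using Qs Ps unfolding sol_on_def by auto
  have sub: "sol_on {c..} Q" "sol_on {c..} P" for c
    using Qs Ps by (auto intro: sol_on_subset)
  define x0 where "x0 = max s 0"
  have x0: "s \<le> x0" "0 \<le> x0" by (auto simp: x0_def)
  have cross: "\<exists>z. x < z \<and> z \<le> leader l Q x \<and> Q z = P z"
    and cross': "\<exists>z. x < z \<and> z \<le> leader l P x \<and> P z = Q z" if "x0 \<le> x" for x
  proof -
    have "s \<le> x" using that x0 by simp
    show "\<exists>z. x < z \<and> z \<le> leader l Q x \<and> Q z = P z"
      by (rule crossing_window[OF sub eq \<open>s \<le> x\<close>]) blast
    show "\<exists>z. x < z \<and> z \<le> leader l P x \<and> P z = Q z"
      by (rule crossing_window[OF sub(2,1) eq[symmetric] \<open>s \<le> x\<close>]) blast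
  qed
  have b_case: "Q z = P z" if "R = Q \<or> R = P" "R 0 = b" "x0 \<le> z" for R z
  proof -
    obtain w where w: "x0 < w" "Q w = P w" using cross[of x0] by auto
    have "sol_on {0..} R" using that(1) sub by auto
    then have "R w = b" using reaches_b_imp_b[of R 0 w] that(2) w x0 by simp
    then have "Q w = b" "P w = b" using that w by auto
    moreover have "0 \<le> w" "0 \<le> z" using w x0 that by auto
    ultimately have "Q z = b" "P z = b" using reaches_b_imp_b sub by blast+
    then show ?thesis by simp
  qed
  have after: "Q z = P z" if "x0 \<le> z" for z
  proof (cases "Q 0 = b \<or> P 0 = b")
    case True
    then show ?thesis using b_case[of Q z] b_case[of P z] that by blast
  next
    case False
    then have "Q 0 < b" "P 0 < b"
      using admissibleD(2)[OF Q, of 0] admissibleD(2)[OF P, of 0] by auto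
    then have "Q z \<le> P z" "P z \<le> Q z"
      using sol_le_of_crossings[OF sub x0(2) cross gap_pos[OF sub(2) limP] that]
        sol_le_of_crossings[OF sub(2,1) x0(2) cross' gap_pos[OF sub(1) limQ] that] by blast+
    then show ?thesis by simp
  qed
  show ?thesis
  proof
    fix x
    show "Q x = P x" by (rule backward_unique[OF sub after order_refl])
  qed
qed

end

subsection \<open>Existence between barriers\<close>

text \<open>\<open>\<alpha> * (1 - exp (- t))\<close> is concave and starts at 0 with slope \<alpha>
  > 1, so it meets the diagonal at a positive \<open>t\<close> and lies below it afterwards. The
  factor 3/2 is the ratio of the two exponents in the barriers.\<close>

lemma exponential_rate:
  fixes \<alpha> :: real
  assumes "1 < \<alpha>"
  obtains t where "0 < t" "\<alpha> * (1 - exp (- t)) = t" "\<alpha> * (1 - exp (- (3 / 2 * t))) < 3 / 2 * t"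
proof -
  define f where "f t = \<alpha> * (1 - exp (- t)) - t" for t :: real
  \<comment> \<open>A positive point with \<open>f t0 \<ge> 0\<close> keeps the intermediate value
    theorem away from the trivial zero at 0.\<close>
  define t0 where "t0 = (\<alpha> - 1) / 2"
  have t0: "0 < t0" "t0 < \<alpha>" using assms by (auto simp: t0_def)
  have "0 \<le> f t0"
  proof -
    have "1 + t0 \<le> exp t0" by (rule exp_ge_add_one_self)
    then have "exp (- t0) \<le> 1 / (1 + t0)"
      using t0 by (simp add: exp_minus divide_simps)
    then have "t0 / (1 + t0) \<le> 1 - exp (- t0)"
      using t0 by (simp add: field_simps)
    then have "\<alpha> * (t0 / (1 + t0)) \<le> \<alpha> * (1 - exp (- t0))"
      using assms by (intro mult_left_mono) auto
    moreover have "t0 * (1 + t0) \<le> t0 * \<alpha>"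
      using t0 assms by (intro mult_left_mono) (auto simp: t0_def field_simps)
    then have "t0 \<le> \<alpha> * (t0 / (1 + t0))"
      using t0 by (simp add: field_simps)
    ultimately show ?thesis by (simp add: f_def)
  qed
  moreover have "f \<alpha> \<le> 0" using assms by (simp add: f_def algebra_simps)
  moreover have "continuous_on {t0..\<alpha>} f" unfolding f_def by (intro continuous_intros)
  ultimately obtain t where t: "t0 \<le> t" "f t = 0"
    using IVT2'[of f \<alpha> 0 t0] t0 by auto
  define y where "y = exp (- (t / 2))"
  have y: "0 < y" "y < 1" using t t0 by (auto simp: y_def)
  have y2: "exp (- t) = y\<^sup>2" and y3: "exp (- (3 / 2 * t)) = y ^ 3"
    unfolding y_def exp_of_nat_mult[symmetric] by (simp_all add: field_simps)
  \<comment> \<open>In terms of \<open>y\<close> the strict inequality is polynomial, with a double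
    root at 1.\<close>
  have "0 < (1 - y) * (1 - y) * (y + 1 / 2)" using y by simp
  also have "(1 - y) * (1 - y) * (y + 1 / 2) = 3 / 2 * (1 - y\<^sup>2) - (1 - y ^ 3)"
    by (simp add: power2_eq_square power3_eq_cube field_simps)
  finally have "1 - y ^ 3 < 3 / 2 * (1 - y\<^sup>2)" by simp
  then have "\<alpha> * (1 - y ^ 3) < \<alpha> * (3 / 2 * (1 - y\<^sup>2))" using assms by simp
  moreover have "\<alpha> * (1 - y\<^sup>2) = t" using t by (simp add: f_def y2)
  moreover have "\<alpha> * (3 / 2 * (1 - y\<^sup>2)) = 3 / 2 * (\<alpha> * (1 - y\<^sup>2))" by simp
  ultimately have lt: "\<alpha> * (1 - exp (- (3 / 2 * t))) < 3 / 2 * t" unfolding y3 by linarith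
  show thesis by (rule that[OF _ _ lt]) (use t t0 in \<open>auto simp: f_def\<close>)
qed

lemma integral_exp_decay:
  fixes \<mu> :: real
  assumes "0 < \<mu>" "x \<le> y"
  shows "((\<lambda>z. exp (- (\<mu> * (z - s)))) has_integral
    (exp (- (\<mu> * (x - s))) - exp (- (\<mu> * (y - s)))) / \<mu>) {x..y}"
proof -
  have "((\<lambda>z. - exp (- (\<mu> * (z - s))) / \<mu>) has_vector_derivative exp (- (\<mu> * (z - s)))) (at z within {x..y})" for z
    using assms(1) unfolding has_real_derivative_iff_has_vector_derivative[symmetric]
    by (auto intro!: derivative_eq_intros)
  from fundamental_theorem_of_calculus[OF assms(2) this]
  show ?thesis by (simp add: diff_divide_distrib)
qed

section \<open>The fixed point map\<close>

context traffic
begin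

text \<open>The density at \<open>x\<close> that would put the leader where a car arrives after the
  time \<open>T\<close> in the profile \<open>Q\<close>; solutions are the fixed points. The value
  at \<open>x\<close> depends on \<open>Q\<close> only from \<open>x\<close> onwards.\<close>

definition update :: "(real \<Rightarrow> real) \<Rightarrow> real \<Rightarrow> real" where
  "update Q x = (THE q. 0 < q \<and> travel Q x (x + l / q) = T)"

lemma travel_ends:
  assumes "admissible Q"
  shows "T \<le> travel Q x (x + l / a)" "travel Q x (x + l / b) \<le> T"
  using travel_bounds(1)[OF assms, of x "x + l / a"] travel_bounds(2)[OF assms, of x "x + l / b"]
    a_pos b_pos l_pos by auto

lemma travel_antimono:
  assumes "admissible Q" "0 < p" "0 < q"
  shows "travel Q x (x + l / p) \<le> travel Q x (x + l / q) \<longleftrightarrow> q \<le> p"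
proof -
  have "travel Q x (x + l / q) < travel Q x (x + l / p) \<longleftrightarrow> p < q"
    using travel_less_iff[OF assms(1), of x "x + l / q" "x + l / p"] assms l_pos
    by (simp add: divide_less_cancel frac_less2 field_simps)
  then show ?thesis by (metis not_le)
qed

lemma update_props:
  assumes Q: "admissible Q"
  shows "0 < update Q x" "travel Q x (x + l / update Q x) = T"
proof -
  have "\<exists>y\<ge>x. y \<le> x + l / a \<and> travel Q x y = T"
  proof (rule IVT')
    have "continuous_on {x..x + l / a} (\<lambda>y. cumulative Q y - cumulative Q x)"
      by (intro continuous_on_diff continuous_on_subset[OF cumulative_continuous[OF Q]]) auto
    then show "continuous_on {x..x + l / a} (travel Q x)"
      by (rule continuous_on_eq) (simp add: travel_eq_cumulative[OF Q])
  qed (use travel_ends[OF Q, of x] T_pos l_pos a_pos in auto)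
  then obtain y where y: "x \<le> y" "travel Q x y = T" by blast
  then have "x < y" using T_pos by (cases "x = y") auto
  define q where "q = l / (y - x)"
  have q: "0 < q" "x + l / q = y" using \<open>x < y\<close> l_pos by (auto simp: q_def)
  have "0 < update Q x \<and> travel Q x (x + l / update Q x) = T"
    unfolding update_def
  proof (rule theI[of _ q])
    show "0 < q \<and> travel Q x (x + l / q) = T" using q y by simp
    fix p assume "0 < p \<and> travel Q x (x + l / p) = T"
    then show "p = q"
      using travel_antimono[OF Q, of p q x] travel_antimono[OF Q, of q p x] q y by auto
  qed
  then show "0 < update Q x" "travel Q x (x + l / update Q x) = T" by auto
qed

lemma le_update_iff:
  assumes "admissible Q" "0 < q"
  shows "q \<le> update Q x \<longleftrightarrow> T \<le> travel Q x (x + l / q)"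
  using travel_antimono[OF assms(1) update_props(1)[OF assms(1), of x] assms(2), of x]
    update_props(2)[OF assms(1), of x] by simp

lemma update_le_iff:
  assumes "admissible Q" "0 < q"
  shows "update Q x \<le> q \<longleftrightarrow> travel Q x (x + l / q) \<le> T"
  using travel_antimono[OF assms(1) assms(2) update_props(1)[OF assms(1), of x], of x]
    update_props(2)[OF assms(1), of x] by simp

lemma update_admissible:
  assumes Q: "admissible Q"
  shows "admissible (update Q)"
  unfolding admissible_def
proof
  show "mono (update Q)"
  proof (rule monoI)
    fix x y :: real assume "x \<le> y"
    have "T \<le> travel Q y (y + l / update Q x)"
      using travel_shift_le[OF Q \<open>x \<le> y\<close>, of "l / update Q x"] update_props[OF Q, of x] l_pos by simp
    then show "update Q x \<le> update Q y"
      using le_update_iff[OF Q update_props(1)[OF Q]] by blast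
  qed
  show "range (update Q) \<subseteq> {a..b}"
    using le_update_iff[OF Q a_pos] update_le_iff[OF Q b_pos] travel_ends[OF Q] by auto
qed

lemma update_mono:
  assumes Q: "admissible Q" and R: "admissible R" and le: "\<And>z. x \<le> z \<Longrightarrow> Q z \<le> R z"
  shows "update Q x \<le> update R x"
proof -
  have "T \<le> travel R x (x + l / update Q x)"
    using travel_le[OF Q R _ le, of x "x + l / update Q x"] update_props[OF Q, of x] l_pos by simp
  then show ?thesis using le_update_iff[OF R update_props(1)[OF Q]] by blast
qed

text \<open>Knaster--Tarski for the order-preserving map \<^const>\<open>update\<close> between two barriers.\<close>

lemma solution_between_barriers:
  assumes S: "admissible S" "\<And>x. S x \<le> U x"
    and inv: "\<And>Q x. admissible Q \<Longrightarrow> (\<And>x. S x \<le> Q x) \<Longrightarrow> (\<And>x. Q x \<le> U x)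
      \<Longrightarrow> S x \<le> update Q x \<and> update Q x \<le> U x"
  obtains Q where "sol_on UNIV Q" "\<And>x. S x \<le> Q x" "\<And>x. Q x \<le> U x"
proof -
  \<comment> \<open>Pointwise suprema of monotone functions are monotone, so the supremum of
    \<open>G\<close> is again admissible; continuity comes only afterwards, from the
    equation.\<close>
  define G where "G = {Q. admissible Q \<and> (\<forall>x. S x \<le> Q x \<and> Q x \<le> U x \<and> Q x \<le> update Q x)}"
  define Q where "Q x = (SUP R\<in>G. R x)" for x
  have S_G: "S \<in> G" unfolding G_def using S inv[OF S(1)] by auto
  have bdd: "bdd_above ((\<lambda>R. R x) ` G)" for x
    by (rule bdd_aboveI[of _ b]) (auto simp: G_def dest: admissibleD(2))
  have upper: "R x \<le> Q x" if "R \<in> G" for R x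
    unfolding Q_def using bdd that by (intro cSUP_upper) auto
  have least: "Q x \<le> c" if "\<And>R. R \<in> G \<Longrightarrow> R x \<le> c" for x c
    unfolding Q_def using S_G that by (intro cSUP_least) auto
  have Q_adm: "admissible Q"
    unfolding admissible_def
  proof
    show "mono Q"
    proof (intro monoI least)
      fix x y :: real and R assume "x \<le> y" "R \<in> G"
      then have "R x \<le> R y" by (auto simp: G_def intro: admissibleD(3))
      then show "R x \<le> Q y" using upper[OF \<open>R \<in> G\<close>, of y] by simp
    qed
    have "Q x \<le> b" "a \<le> Q x" for x
      using least[of x b] upper[OF S_G, of x] admissibleD(1)[OF S(1), of x]
      by (auto simp: G_def intro: admissibleD(2))
    then show "range Q \<subseteq> {a..b}" by auto
  qed
  have S_Q: "S x \<le> Q x" for x by (rule upper[OF S_G])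
  have Q_U: "Q x \<le> U x" for x by (rule least) (auto simp: G_def)
  have Q_up: "Q x \<le> update Q x" for x
  proof (rule least)
    fix R assume "R \<in> G"
    then have "R x \<le> update R x" "admissible R" by (auto simp: G_def)
    moreover have "update R x \<le> update Q x"
      using \<open>admissible R\<close> upper[OF \<open>R \<in> G\<close>] by (intro update_mono Q_adm) auto
    ultimately show "R x \<le> update Q x" by simp
  qed
  have up_adm: "admissible (update Q)" by (rule update_admissible[OF Q_adm])
  have "update Q \<in> G"
    unfolding G_def using up_adm inv[OF Q_adm S_Q Q_U] update_mono[OF Q_adm up_adm Q_up] by auto
  then have fixed: "update Q x = Q x" for x
    using upper[of "update Q" x] Q_up[of x] by simp
  have "sol_on UNIV Q"
    unfolding sol_on_def leader_def using Q_adm update_props(2)[OF Q_adm] fixed by simp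
  then show thesis using that S_Q Q_U by blast
qed

section \<open>Second-order expansion of travel times at \<open>b\<close>\<close>

lemma K_nonneg: "0 \<le> K"
proof -
  have "0 \<le> K * (b - a)" using F'_near_b[of a] a_less by (simp add: order_trans[OF abs_ge_zero])
  then show ?thesis using a_less by (simp add: zero_le_mult_iff)
qed

lemma F'_b_pos: "0 < F' b"
  using F'_lower[of b] a_less m_pos by simp

text \<open>A Lipschitz bound for \<open>F'\<close> at the single point \<open>b\<close> suffices
  for a quadratic remainder, by the mean value theorem.\<close>

lemma F_taylor:
  assumes "0 \<le> v" "a \<le> b - v"
  shows "\<bar>F (b - v) - (F b - F' b * v)\<bar> \<le> K * v\<^sup>2"
proof -
  obtain w where w: "b - v \<le> w" "w \<le> b" "F b - F (b - v) = F' w * (b - (b - v))"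
    using F_mvt[of "b - v" b] assms by auto
  have "F (b - v) - (F b - F' b * v) = (F' b - F' w) * v"
    using w(3) by (simp add: algebra_simps)
  then have "\<bar>F (b - v) - (F b - F' b * v)\<bar> = \<bar>F' w - F' b\<bar> * v"
    using assms(1) by (simp add: abs_mult abs_minus_commute)
  also have "\<dots> \<le> K * v * v"
  proof (rule mult_right_mono)
    have "\<bar>F' w - F' b\<bar> \<le> K * (b - w)" using F'_near_b[of w] w assms by simp
    also have "\<dots> \<le> K * v" using w K_nonneg by (intro mult_left_mono) auto
    finally show "\<bar>F' w - F' b\<bar> \<le> K * v" .
  qed fact
  finally show ?thesis by (simp add: power2_eq_square)
qed

text \<open>The terms bound the quadratic part of \<open>l / (b - u x)\<close>, the Taylor remainder
  of \<open>F\<close>, and the integral of \<open>u\<close> beyond \<open>x + l / b\<close>. The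
  upper expansion uses the first two, the lower one the last two.\<close>

definition err :: real where
  "err = (F b * l / (a * b\<^sup>2) + K * l / a + F' b * l / (a * b)) / Vp"

lemma err_eq: "err * U\<^sup>2 = F b / Vp * (l / (b\<^sup>2 * a) * U\<^sup>2) + K * U\<^sup>2 / Vp * (l / a)
    + F' b / Vp * (l / (a * b) * U\<^sup>2)"
  unfolding err_def add_divide_distrib distrib_right by (simp add: mult_ac)

text \<open>Both estimates linearise the travel time around the constant solution \<open>b\<close>.\<close>

lemma travel_upper_expansion:
  assumes Q: "admissible Q" and x: "0 \<le> x" and cont: "continuous_on UNIV u"
    and u: "\<And>z. x \<le> z \<Longrightarrow> 0 \<le> u z" "\<And>z. x \<le> z \<Longrightarrow> u z \<le> U" "\<And>z. x \<le> z \<Longrightarrow> a \<le> b - u z"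
    and le: "\<And>z. x \<le> z \<Longrightarrow> Q z \<le> b - u z"
  shows "travel Q x (x + l / (b - u x)) \<le>
    T + (F b * l / b\<^sup>2 * u x - F' b * integral {x..x + l / b} u) / Vp + err * U\<^sup>2"
proof -
  define q where "q = b - u x"
  have q: "a \<le> q" "0 < q" "q \<le> b" using u[of x] a_pos by (auto simp: q_def)
  define y where "y = x + l / q"
  have y: "x \<le> y" "x + l / b \<le> y" using q l_pos by (auto simp: y_def frac_le)
  have int: "u integrable_on {c..d}" for c d
    by (intro integrable_continuous_real continuous_on_subset[OF cont]) auto
  have "integral {x..y} (slowness Q) \<le> integral {x..y} (\<lambda>z. (F b + K * U\<^sup>2) / Vp - F' b / Vp * u z)"
  proof (rule integral_le)
    fix z assume z: "z \<in> {x..y}"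
    have "F (Q z) \<le> F (b - u z)" using le[of z] u[of z] z admissibleD(1)[OF Q] by (intro F_mono) auto
    also have "\<dots> \<le> F b - F' b * u z + K * (u z)\<^sup>2" using F_taylor[of "u z"] u[of z] z by auto
    also have "\<dots> \<le> F b - F' b * u z + K * U\<^sup>2"
      using u[of z] z K_nonneg by (intro add_left_mono mult_left_mono power_mono) auto
    finally have "F (Q z) / Vp \<le> (F b - F' b * u z + K * U\<^sup>2) / Vp"
      using Vp_pos by (simp add: divide_right_mono)
    then show "slowness Q z \<le> (F b + K * U\<^sup>2) / Vp - F' b / Vp * u z"
      using x z by (simp add: slowness_nonneg diff_divide_distrib add_divide_distrib)
  qed (intro slowness_integrable[OF Q] integrable_diff integrable_on_mult_right integrable_const_ivl int)+
  also have "\<dots> = (F b + K * U\<^sup>2) / Vp * (y - x) - F' b / Vp * integral {x..y} u"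
    using y by (subst integral_diff) (simp_all add: integrable_const_ivl integrable_on_mult_right[OF int, of "F' b / Vp", simplified])
  \<comment> \<open>The integral of \<open>u \<ge> 0\<close> enters with a minus sign, so shortening
    its interval is free.\<close>
  also have "\<dots> \<le> (F b + K * U\<^sup>2) / Vp * (y - x) - F' b / Vp * integral {x..x + l / b} u"
  proof -
    have "integral {x..x + l / b} u \<le> integral {x..y} u"
      using y u(1) int by (intro integral_subset_le) auto
    then show ?thesis using F'_b_pos Vp_pos by (intro diff_left_mono mult_left_mono) auto
  qed
  also have "y - x = l / b + l / b\<^sup>2 * u x + l / (b\<^sup>2 * q) * (u x)\<^sup>2"
    using q b_pos by (simp add: y_def q_def power2_eq_square field_simps)
  also have "(F b + K * U\<^sup>2) / Vp * (l / b + l / b\<^sup>2 * u x + l / (b\<^sup>2 * q) * (u x)\<^sup>2)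
      = T + F b / Vp * (l / b\<^sup>2 * u x) + F b / Vp * (l / (b\<^sup>2 * q) * (u x)\<^sup>2) + K * U\<^sup>2 / Vp * (l / q)"
  proof -
    have lq: "l / b + l / b\<^sup>2 * u x + l / (b\<^sup>2 * q) * (u x)\<^sup>2 = l / q" (is "?s = _")
      using q b_pos by (simp add: q_def power2_eq_square field_simps)
    have "(F b + K * U\<^sup>2) / Vp * ?s = F b / Vp * ?s + K * U\<^sup>2 / Vp * ?s"
      by (simp only: add_divide_distrib distrib_right)
    moreover have "F b / Vp * ?s = F b / Vp * (l / b) + F b / Vp * (l / b\<^sup>2 * u x)
        + F b / Vp * (l / (b\<^sup>2 * q) * (u x)\<^sup>2)"
      by (simp only: distrib_left)
    ultimately show ?thesis unfolding equilibrium_b lq by linarith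
  qed
  finally have main: "travel Q x y \<le> T + F b / Vp * (l / b\<^sup>2 * u x) + F b / Vp * (l / (b\<^sup>2 * q) * (u x)\<^sup>2)
      + K * U\<^sup>2 / Vp * (l / q) - F' b / Vp * integral {x..x + l / b} u"
    unfolding travel_def by simp
  have "F b / Vp * (l / (b\<^sup>2 * q) * (u x)\<^sup>2) \<le> F b / Vp * (l / (b\<^sup>2 * a) * U\<^sup>2)"
    using F_b_pos Vp_pos l_pos q a_pos b_pos u[of x]
    by (intro mult_left_mono mult_mono frac_le power_mono mult_left_mono) auto
  moreover have "K * U\<^sup>2 / Vp * (l / q) \<le> K * U\<^sup>2 / Vp * (l / a)"
    using K_nonneg Vp_pos l_pos q a_pos by (intro mult_left_mono frac_le) auto
  moreover have "F b / Vp * (l / (b\<^sup>2 * a) * U\<^sup>2) + K * U\<^sup>2 / Vp * (l / a) \<le> err * U\<^sup>2"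
    unfolding err_eq using F'_b_pos l_pos a_pos b_pos Vp_pos by simp
  ultimately have "travel Q x y \<le> T + F b / Vp * (l / b\<^sup>2 * u x) - F' b / Vp * integral {x..x + l / b} u + err * U\<^sup>2"
    using main by linarith
  then show ?thesis unfolding y_def q_def by (simp add: diff_divide_distrib mult_ac)
qed

lemma travel_lower_expansion:
  assumes Q: "admissible Q" and x: "0 \<le> x" and cont: "continuous_on UNIV u"
    and u: "\<And>z. x \<le> z \<Longrightarrow> 0 \<le> u z" "\<And>z. x \<le> z \<Longrightarrow> u z \<le> U" "\<And>z. x \<le> z \<Longrightarrow> a \<le> b - u z"
    and ge: "\<And>z. x \<le> z \<Longrightarrow> b - u z \<le> Q z"
  shows "T + (F b * l / b\<^sup>2 * u x - F' b * integral {x..x + l / b} u) / Vp - err * U\<^sup>2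
    \<le> travel Q x (x + l / (b - u x))"
proof -
  define q where "q = b - u x"
  have q: "a \<le> q" "0 < q" "q \<le> b" using u[of x] a_pos by (auto simp: q_def)
  define y where "y = x + l / q"
  have y: "x \<le> y" "x \<le> x + l / b" "x + l / b \<le> y" using q l_pos b_pos by (auto simp: y_def frac_le)
  have int: "u integrable_on {c..d}" for c d
    by (intro integrable_continuous_real continuous_on_subset[OF cont]) auto
  have U: "0 \<le> U" using u[of x] by simp
  have y_eq: "y - x = l / b + l / (b * q) * u x"
    using q b_pos by (simp add: y_def q_def field_simps)
  have "F b / Vp * (l / b + l / b\<^sup>2 * u x) - K * U\<^sup>2 / Vp * (l / a)
      - F' b / Vp * (integral {x..x + l / b} u + l / (a * b) * U\<^sup>2)
    \<le> F b / Vp * (y - x) - K * U\<^sup>2 / Vp * (y - x) - F' b / Vp * integral {x..y} u"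
  proof (intro diff_mono mult_left_mono)
    have "l / b\<^sup>2 * u x \<le> l / (b * q) * u x"
      using q b_pos l_pos u(1)[of x]
      by (intro mult_right_mono divide_left_mono) (auto simp: power2_eq_square)
    then show "l / b + l / b\<^sup>2 * u x \<le> y - x" using y_eq by simp
    show "y - x \<le> l / a" using q a_pos l_pos by (simp add: y_def frac_le)
    \<comment> \<open>In this direction the stretch beyond \<open>x + l / b\<close> has to be paid
      for; its length is of the order of \<open>u x\<close>, hence its contribution is of the order
      of \<open>U\<^sup>2\<close>.\<close>
    have "integral {x..y} u = integral {x..x + l / b} u + integral {x + l / b..y} u"
      by (rule Henstock_Kurzweil_Integration.integral_combine[symmetric]) (use y int in auto)
    moreover have "integral {x + l / b..y} u \<le> integral {x + l / b..y} (\<lambda>_. U)"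
      using y u(2) int by (intro integral_le) auto
    moreover have "y - (x + l / b) = l / (b * q) * u x" using y_eq by simp
    then have "integral {x + l / b..y} (\<lambda>_. U) = l / (b * q) * u x * U"
      using y by simp
    moreover have "l / (b * q) \<le> l / (b * a)"
      using q a_pos b_pos l_pos by (intro divide_left_mono mult_left_mono mult_pos_pos) auto
    then have "l / (b * q) * u x * U \<le> l / (b * a) * U * U"
      using q a_pos b_pos l_pos u[of x] U by (intro mult_right_mono mult_mono) auto
    ultimately show "integral {x..y} u \<le> integral {x..x + l / b} u + l / (a * b) * U\<^sup>2"
      by (simp add: power2_eq_square mult.commute[of b a])
  qed (use F_b_pos Vp_pos K_nonneg F'_b_pos in auto)
  also have "F b / Vp * (y - x) - K * U\<^sup>2 / Vp * (y - x) = (F b - K * U\<^sup>2) / Vp * (y - x)"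
    by (simp only: diff_divide_distrib left_diff_distrib)
  also have "(F b - K * U\<^sup>2) / Vp * (y - x) - F' b / Vp * integral {x..y} u
      = integral {x..y} (\<lambda>z. (F b - K * U\<^sup>2) / Vp - F' b / Vp * u z)"
    using y by (subst integral_diff)
      (simp_all add: integrable_const_ivl integrable_on_mult_right[OF int, of "F' b / Vp", simplified])
  also have "\<dots> \<le> integral {x..y} (slowness Q)"
  proof (rule integral_le)
    fix z assume z: "z \<in> {x..y}"
    have "F b - F' b * u z - K * U\<^sup>2 \<le> F b - F' b * u z - K * (u z)\<^sup>2"
      using u[of z] z K_nonneg by (intro diff_left_mono mult_left_mono power_mono) auto
    also have "\<dots> \<le> F (b - u z)" using F_taylor[of "u z"] u[of z] z by auto
    also have "\<dots> \<le> F (Q z)" using ge[of z] u[of z] z admissibleD(2)[OF Q] by (intro F_mono) auto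
    finally have "(F b - F' b * u z - K * U\<^sup>2) / Vp \<le> F (Q z) / Vp"
      using Vp_pos by (simp add: divide_right_mono)
    then show "(F b - K * U\<^sup>2) / Vp - F' b / Vp * u z \<le> slowness Q z"
      using x z by (simp add: slowness_nonneg diff_divide_distrib)
  qed (intro slowness_integrable[OF Q] integrable_diff integrable_on_mult_right integrable_const_ivl int)+
  finally have main: "F b / Vp * (l / b + l / b\<^sup>2 * u x) - K * U\<^sup>2 / Vp * (l / a)
      - F' b / Vp * (integral {x..x + l / b} u + l / (a * b) * U\<^sup>2) \<le> travel Q x y"
    unfolding travel_def .
  have "F b / Vp * (l / b + l / b\<^sup>2 * u x) = T + F b / Vp * (l / b\<^sup>2 * u x)"
    using equilibrium_b by (simp add: distrib_left)
  moreover have "K * U\<^sup>2 / Vp * (l / a) + F' b / Vp * (l / (a * b) * U\<^sup>2) \<le> err * U\<^sup>2"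
    unfolding err_eq using F_b_pos l_pos a_pos b_pos Vp_pos by simp
  moreover have "F' b / Vp * (integral {x..x + l / b} u + l / (a * b) * U\<^sup>2)
      = F' b / Vp * integral {x..x + l / b} u + F' b / Vp * (l / (a * b) * U\<^sup>2)"
    by (rule distrib_left)
  ultimately have "T + F b / Vp * (l / b\<^sup>2 * u x) - F' b / Vp * integral {x..x + l / b} u - err * U\<^sup>2 \<le> travel Q x y"
    using main by linarith
  then show ?thesis unfolding y_def q_def by (simp add: diff_divide_distrib mult_ac)
qed

end

subsection \<open>Exponential barriers at the right end\<close>

text \<open>Powers of one exponential, so that comparing terms is comparing powers of a number below
  1. Subtracted from \<open>b\<close>, it gives the lower barrier for \<sigma> = 1 and the upper one
  for \<sigma> = -1.\<close>

definition tail :: "real \<Rightarrow> real \<Rightarrow> real \<Rightarrow> real \<Rightarrow> real" where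
  "tail \<omega> s \<sigma> z = exp (- (\<omega> * (z - s))) ^ 2 + \<sigma> * exp (- (\<omega> * (z - s))) ^ 3"

lemma integral_tail:
  fixes \<omega> s :: real
  assumes "0 < \<omega>" "0 \<le> L"
  shows "integral {x..x + L} (tail \<omega> s \<sigma>) =
    exp (- (\<omega> * (x - s))) ^ 2 * (1 - exp (- (2 * \<omega> * L))) / (2 * \<omega>)
    + \<sigma> * (exp (- (\<omega> * (x - s))) ^ 3 * (1 - exp (- (3 * \<omega> * L))) / (3 * \<omega>))"
proof (rule integral_unique)
  have pow: "exp (- (\<omega> * (z - s))) ^ n = exp (- (real n * \<omega> * (z - s)))" for z n
    by (simp add: exp_of_nat_mult[symmetric] mult_ac)
  have shift: "exp (- (c * (x + L - s))) = exp (- (c * (x - s))) * exp (- (c * L))" for c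
    by (simp add: exp_add[symmetric] algebra_simps)
  have "((\<lambda>z. exp (- (2 * \<omega> * (z - s))) + \<sigma> * exp (- (3 * \<omega> * (z - s)))) has_integral
      (exp (- (2 * \<omega> * (x - s))) - exp (- (2 * \<omega> * (x + L - s)))) / (2 * \<omega>)
      + \<sigma> * ((exp (- (3 * \<omega> * (x - s))) - exp (- (3 * \<omega> * (x + L - s)))) / (3 * \<omega>))) {x..x + L}"
    using assms by (intro has_integral_add has_integral_mult_right integral_exp_decay) auto
  then show "(tail \<omega> s \<sigma> has_integral exp (- (\<omega> * (x - s))) ^ 2 * (1 - exp (- (2 * \<omega> * L))) / (2 * \<omega>)
    + \<sigma> * (exp (- (\<omega> * (x - s))) ^ 3 * (1 - exp (- (3 * \<omega> * L))) / (3 * \<omega>))) {x..x + L}"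
    unfolding tail_def[abs_def] pow shift by (simp add: right_diff_distrib)
qed

lemma exp_decay_tendsto:
  fixes \<omega> s :: real
  assumes "0 < \<omega>"
  shows "((\<lambda>x. exp (- (\<omega> * (x - s)))) \<longlongrightarrow> 0) at_top"
proof (rule filterlim_compose[OF exp_at_bot])
  show "filterlim (\<lambda>x. - (\<omega> * (x - s))) at_bot at_top"
    unfolding filterlim_at_bot
  proof
    fix Z :: real
    have "- (\<omega> * (x - s)) \<le> Z" if "s - Z / \<omega> \<le> x" for x
      using that assms by (simp add: field_simps)
    then show "\<forall>\<^sub>F x in at_top. - (\<omega> * (x - s)) \<le> Z"
      unfolding eventually_at_top_linorder by blast
  qed
qed

context traffic
begin

text \<open>The rate \<open>2\<omega>\<close> of the leading term solves the characteristic equation of the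
  linearisation at \<open>b\<close>; the correction term decides the sign of the residual.\<close>

lemma tail_residual:
  obtains \<omega> \<theta> where "0 < \<omega>" "0 < \<theta>"
    "\<And>s \<sigma> x. (F b * l / b\<^sup>2 * tail \<omega> s \<sigma> x - F' b * integral {x..x + l / b} (tail \<omega> s \<sigma>)) / Vp
      = T / b * \<theta> * (\<sigma> * exp (- (\<omega> * (x - s))) ^ 3)"
proof -
  define \<alpha> where "\<alpha> = b * F' b / F b"
  have "1 < \<alpha>" using F'_b F_b_pos by (simp add: \<alpha>_def)
  then obtain t where t: "0 < t" "\<alpha> * (1 - exp (- t)) = t" "\<alpha> * (1 - exp (- (3 / 2 * t))) < 3 / 2 * t"
    using exponential_rate by blast
  \<comment> \<open>Over the equilibrium spacing \<open>l / b\<close> the square of the exponential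
    now decays by \<open>exp (- t)\<close> and the cube by \<open>exp (- (3 / 2 * t))\<close>. The
    square cancels in the residual; \<theta> is the fraction of the local term that survives for the
    cube.\<close>
  define \<omega> where "\<omega> = t * b / (2 * l)"
  define \<theta> where "\<theta> = 1 - \<alpha> * (1 - exp (- (3 / 2 * t))) / (3 / 2 * t)"
  have \<omega>: "0 < \<omega>" using t l_pos b_pos by (simp add: \<omega>_def)
  have \<theta>: "0 < \<theta>" using t by (simp add: \<theta>_def field_simps)
  have \<omega>l: "2 * \<omega> * (l / b) = t" "3 * \<omega> * (l / b) = 3 / 2 * t"
    using l_pos b_pos by (auto simp: \<omega>_def)
  have F'_eq: "F' b = \<alpha> * F b / b" using F_b_pos b_pos by (simp add: \<alpha>_def)
  have coeff: "F b * l / b\<^sup>2 / Vp = T / b"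
    using equilibrium_b by (simp add: power2_eq_square mult_ac flip: equilibrium_b)
  have "F' b * ((1 - exp (- t)) / (2 * \<omega>)) = F b * l / b\<^sup>2 * (\<alpha> * (1 - exp (- t)) / t)"
    unfolding F'_eq \<omega>_def using b_pos t(1) by (simp add: field_simps power2_eq_square)
  then have first: "F' b * ((1 - exp (- t)) / (2 * \<omega>)) = F b * l / b\<^sup>2"
    unfolding t(2) using t(1) by simp
  have "F' b * ((1 - exp (- (3 / 2 * t))) / (3 * \<omega>))
      = F b * l / b\<^sup>2 * (\<alpha> * (1 - exp (- (3 / 2 * t))) / (3 / 2 * t))"
    unfolding F'_eq \<omega>_def using b_pos t(1) by (simp add: field_simps power2_eq_square)
  then have second: "F' b * ((1 - exp (- (3 / 2 * t))) / (3 * \<omega>)) = F b * l / b\<^sup>2 * (1 - \<theta>)"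
    by (simp add: \<theta>_def)
  have "(F b * l / b\<^sup>2 * tail \<omega> s \<sigma> x - F' b * integral {x..x + l / b} (tail \<omega> s \<sigma>)) / Vp
      = T / b * \<theta> * (\<sigma> * exp (- (\<omega> * (x - s))) ^ 3)" for s \<sigma> x
  proof -
    define E where "E = exp (- (\<omega> * (x - s)))"
    have tail: "tail \<omega> s \<sigma> x = E ^ 2 + \<sigma> * E ^ 3" by (simp add: tail_def E_def)
    have "F' b * integral {x..x + l / b} (tail \<omega> s \<sigma>)
        = F' b * ((1 - exp (- t)) / (2 * \<omega>)) * E ^ 2
          + F' b * ((1 - exp (- (3 / 2 * t))) / (3 * \<omega>)) * (\<sigma> * E ^ 3)"
      using \<omega> l_pos b_pos by (subst integral_tail) (simp_all only: \<omega>l E_def[symmetric], simp_all add: distrib_left mult_ac)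
    also have "\<dots> = F b * l / b\<^sup>2 * E ^ 2 + F b * l / b\<^sup>2 * (1 - \<theta>) * (\<sigma> * E ^ 3)"
      unfolding first second ..
    finally have "F b * l / b\<^sup>2 * tail \<omega> s \<sigma> x - F' b * integral {x..x + l / b} (tail \<omega> s \<sigma>)
        = F b * l / b\<^sup>2 * (\<theta> * (\<sigma> * E ^ 3))"
      unfolding tail
      by (simp only: distrib_left right_diff_distrib left_diff_distrib mult_1_right mult_1_left mult.assoc)
    then show ?thesis unfolding E_def[symmetric] by (simp add: coeff[symmetric])
  qed
  with \<omega> \<theta> that show thesis by blast
qed

lemma err_pos: "0 < err"
  unfolding err_def using F_b_pos l_pos a_pos b_pos K_nonneg F'_b_pos Vp_pos
  by (intro divide_pos_pos add_pos_nonneg add_nonneg_nonneg) (auto intro: add_pos_nonneg)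

text \<open>Since the delay looks ahead only, the barriers can be the trivial ones \<open>a\<close>
  and \<open>b\<close> up to \<open>X + s\<close>. The condition \<open>s \<ge> 0\<close> keeps the
  remaining region right of 0, where the expansions hold.\<close>

lemma asymptotic_solutions:
  obtains \<omega> X where "0 < \<omega>" "0 \<le> X"
    "\<And>s. 0 \<le> s \<Longrightarrow> \<exists>Q. sol_on UNIV Q \<and>
      (\<forall>x\<ge>X + s. b - tail \<omega> s 1 x \<le> Q x \<and> Q x \<le> b - tail \<omega> s (- 1) x)"
proof -
  obtain \<omega> \<theta> where \<omega>: "0 < \<omega>" and \<theta>: "0 < \<theta>"
    and residual: "\<And>s \<sigma> x. (F b * l / b\<^sup>2 * tail \<omega> s \<sigma> x - F' b * integral {x..x + l / b} (tail \<omega> s \<sigma>)) / Vp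
      = T / b * \<theta> * (\<sigma> * exp (- (\<omega> * (x - s))) ^ 3)"
    using tail_residual by blast
  \<comment> \<open>An upper bound for the exponential: 1 orders its powers,
    \<open>(b - a) / 2\<close> keeps the barriers above \<open>a\<close>, and the last term makes
    the fourth-order error at most the cubic residual.\<close>
  define \<delta> where "\<delta> = min (min 1 ((b - a) / 2)) (T / b * \<theta> / (4 * err))"
  have \<delta>: "0 < \<delta>" "\<delta> \<le> 1" "\<delta> \<le> (b - a) / 2" "4 * err * \<delta> \<le> T / b * \<theta>"
  proof -
    show "0 < \<delta>" using a_less T_pos b_pos \<theta> err_pos by (simp add: \<delta>_def)
    show "\<delta> \<le> 1" "\<delta> \<le> (b - a) / 2" unfolding \<delta>_def by linarith+
    have "\<delta> \<le> T / b * \<theta> / (4 * err)" by (simp add: \<delta>_def)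
    then have "\<delta> * (4 * err) \<le> T / b * \<theta>"
      using pos_le_divide_eq[of "4 * err" \<delta> "T / b * \<theta>"] mult_pos_pos[OF _ err_pos, of 4] by simp
    then show "4 * err * \<delta> \<le> T / b * \<theta>" by (simp add: mult_ac)
  qed
  define X where "X = max 0 (- ln \<delta> / \<omega>)"
  have X: "0 \<le> X" by (simp add: X_def)
  have E_small: "exp (- (\<omega> * (x - s))) \<le> \<delta>" if "X + s \<le> x" for x s
  proof -
    have "- ln \<delta> / \<omega> \<le> x - s" using that by (simp add: X_def)
    then have "- (\<omega> * (x - s)) \<le> ln \<delta>" using \<omega> by (simp add: field_simps)
    then show ?thesis using \<delta>(1) by (simp add: ln_ge_iff)
  qed
  have "\<exists>Q. sol_on UNIV Q \<and> (\<forall>x\<ge>X + s. b - tail \<omega> s 1 x \<le> Q x \<and> Q x \<le> b - tail \<omega> s (- 1) x)"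
    if s: "0 \<le> s" for s
  proof -
    define E where "E z = exp (- (\<omega> * (z - s)))" for z
    have E: "0 < E z" "E z \<le> \<delta>" "E z \<le> 1" if "X + s \<le> z" for z
      using E_small[OF that] order_trans[OF E_small[OF that] \<delta>(2)] unfolding E_def
      by (simp_all only: exp_gt_zero)
    have E_mono: "E z \<le> E x" if "x \<le> z" for x z
      using that \<omega> by (simp add: E_def)
    have tail: "tail \<omega> s \<sigma> z = E z ^ 2 + \<sigma> * E z ^ 3" for \<sigma> z by (simp add: tail_def E_def)
    have cube: "0 < E z ^ 3" "E z ^ 3 \<le> E z ^ 2" "E z ^ 2 \<le> E z" if "X + s \<le> z" for z
      using E[OF that] power_decreasing[of 2 3 "E z"] power_decreasing[of 1 2 "E z"] by auto
    have tail_bounds: "0 \<le> tail \<omega> s \<sigma> z" "tail \<omega> s \<sigma> z \<le> 2 * E x ^ 2" "a \<le> b - tail \<omega> s \<sigma> z"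
      if \<sigma>: "\<sigma> = 1 \<or> \<sigma> = - 1" and "X + s \<le> x" "x \<le> z" for \<sigma> x z
    proof -
      have z: "X + s \<le> z" using that by simp
      show "0 \<le> tail \<omega> s \<sigma> z" using \<sigma> cube[OF z] by (auto simp: tail)
      have "E z ^ 2 \<le> E x ^ 2" using E_mono[OF that(3)] E[OF z] by (intro power_mono) auto
      moreover have "\<sigma> * E z ^ 3 \<le> E z ^ 2" using \<sigma> cube[OF z] E[OF z] by (auto intro: order_trans[of _ 0])
      ultimately show "tail \<omega> s \<sigma> z \<le> 2 * E x ^ 2" unfolding tail by linarith
      have "E z ^ 2 \<le> (b - a) / 2" using cube(3)[OF z] E(2)[OF z] \<delta>(3) by simp
      then have "2 * E z ^ 2 \<le> b - a" by simp
      then show "a \<le> b - tail \<omega> s \<sigma> z"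
        using \<open>\<sigma> * E z ^ 3 \<le> E z ^ 2\<close> unfolding tail by simp
    qed
    have cont: "continuous_on UNIV (tail \<omega> s \<sigma>)" for \<sigma>
      unfolding tail_def[abs_def] by (intro continuous_intros)
    have small: "err * (2 * E x ^ 2)\<^sup>2 \<le> T / b * \<theta> * E x ^ 3" if "X + s \<le> x" for x
    proof -
      have "err * (2 * E x ^ 2)\<^sup>2 = 4 * err * E x * E x ^ 3"
        by (simp add: power2_eq_square power3_eq_cube)
      also have "\<dots> \<le> 4 * err * \<delta> * E x ^ 3"
        using E[OF that] err_pos by (intro mult_right_mono mult_left_mono) auto
      also have "\<dots> \<le> T / b * \<theta> * E x ^ 3"
        using \<delta>(4) E[OF that] by (intro mult_right_mono) auto
      finally show ?thesis .
    qed
    define S where "S x = (if x < X + s then a else b - tail \<omega> s 1 x)" for x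
    define U where "U x = (if x < X + s then b else b - tail \<omega> s (- 1) x)" for x
    have S_adm: "admissible S"
      unfolding admissible_def
    proof
      show "mono S"
      proof (rule monoI)
        fix x y :: real assume "x \<le> y"
        moreover have "tail \<omega> s 1 y \<le> tail \<omega> s 1 x"
          using E_mono[OF \<open>x \<le> y\<close>] by (auto simp: tail E_def intro!: add_mono power_mono)
        ultimately show "S x \<le> S y"
          using tail_bounds(3)[of 1 y y] by (auto simp: S_def)
      qed
      show "range S \<subseteq> {a..b}"
        using tail_bounds(1,3)[of 1] a_less by (auto simp: S_def not_less)
    qed
    have S_U: "S x \<le> U x" for x
      using a_less cube(1)[of x] by (auto simp: S_def U_def tail)
    obtain Q where Q: "sol_on UNIV Q" "\<And>x. S x \<le> Q x" "\<And>x. Q x \<le> U x"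
    proof (rule solution_between_barriers[OF S_adm S_U])
      fix Q x assume Q: "admissible Q" and SQ: "\<And>x. S x \<le> Q x" and QU: "\<And>x. Q x \<le> U x"
      show "S x \<le> update Q x \<and> update Q x \<le> U x"
      proof (cases "x < X + s")
        case True
        then show ?thesis using admissibleD[OF update_admissible[OF Q], of x] by (simp add: S_def U_def)
      next
        case False
        then have x: "X + s \<le> x" "0 \<le> x" using s X by auto
        have pos: "0 < b - tail \<omega> s \<sigma> x" if "\<sigma> = 1 \<or> \<sigma> = - 1" for \<sigma>
          using tail_bounds(3)[OF that x(1) order_refl] a_pos by simp
        have "travel Q x (x + l / (b - tail \<omega> s (- 1) x))
            \<le> T + T / b * \<theta> * (- 1 * E x ^ 3) + err * (2 * E x ^ 2)\<^sup>2"
          unfolding residual[of s "- 1" x, folded E_def, symmetric]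
        proof (rule travel_upper_expansion[OF Q x(2) cont])
          show "Q z \<le> b - tail \<omega> s (- 1) z" if "x \<le> z" for z
            using QU[of z] that x by (simp add: U_def)
        qed (use tail_bounds[of "- 1", OF _ x(1)] in auto)
        then have "travel Q x (x + l / (b - tail \<omega> s (- 1) x)) \<le> T"
          using small[OF x(1)] by simp
        moreover have "T + T / b * \<theta> * (1 * E x ^ 3) - err * (2 * E x ^ 2)\<^sup>2
            \<le> travel Q x (x + l / (b - tail \<omega> s 1 x))"
          unfolding residual[of s 1 x, folded E_def, symmetric]
        proof (rule travel_lower_expansion[OF Q x(2) cont])
          show "b - tail \<omega> s 1 z \<le> Q z" if "x \<le> z" for z
            using SQ[of z] that x by (simp add: S_def)
        qed (use tail_bounds[of 1, OF _ x(1)] in auto)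
        then have "T \<le> travel Q x (x + l / (b - tail \<omega> s 1 x))"
          using small[OF x(1)] by simp
        ultimately show ?thesis
          using False le_update_iff[OF Q pos[of 1]] update_le_iff[OF Q pos[of "- 1"]]
          by (simp add: S_def U_def)
      qed
    qed blast
    have "b - tail \<omega> s 1 x \<le> Q x \<and> Q x \<le> b - tail \<omega> s (- 1) x" if "X + s \<le> x" for x
      using Q(2,3)[of x] that by (simp add: S_def U_def)
    then show ?thesis using Q(1) by blast
  qed
  with \<omega> X that show thesis by blast
qed

text \<open>The limit exists by monotonicity and is an equilibrium for \<open>Vm\<close>; by
  \<open>flux_above\<close> the only one in \<open>{a..b}\<close> is \<open>a\<close>. The left
  boundary condition is thus automatic.\<close>

lemma sol_at_bot:
  assumes "sol_on UNIV Q"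
  shows "(Q \<longlongrightarrow> a) at_bot"
proof -
  have Q: "admissible Q" and T: "\<And>x. travel Q x (leader l Q x) = T"
    using assms unfolding sol_on_def by auto
  define c where "c = Inf (range Q)"
  have bdd: "bdd_below (range Q)" using admissibleD(1)[OF Q] by (intro bdd_belowI[of _ a]) auto
  have c: "(Q \<longlongrightarrow> c) at_bot"
  proof (rule order_tendstoI)
    fix y assume "y < c"
    then have "y < Q x" for x using cInf_lower[OF _ bdd, of "Q x"] by (simp add: c_def)
    then show "\<forall>\<^sub>F x in at_bot. y < Q x" by simp
  next
    fix y assume "c < y"
    then obtain x0 where x0: "Q x0 < y" using cInf_lessD[of "range Q" y] by (auto simp: c_def)
    have "Q x < y" if "x \<le> x0" for x using admissibleD(3)[OF Q that] x0 by simp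
    then show "\<forall>\<^sub>F x in at_bot. Q x < y" unfolding eventually_at_bot_linorder by blast
  qed
  have "((\<lambda>_::real. T) \<longlongrightarrow> F c / Vm * (l / c)) at_bot"
    using travel_leader_at_bot[OF Q c] T by simp
  then have eq: "F c / Vm * (l / c) = T" by (simp add: tendsto_const_iff)
  have range: "a \<le> c" "c \<le> b" using limit_in_range[OF Q c] by auto
  have "c = a"
  proof (rule ccontr)
    assume "c \<noteq> a"
    then have "l * F c < c * Vm * T" using flux_above[of c] range by simp
    then show False using eq range a_pos Vm_pos by (simp add: field_simps)
  qed
  then show ?thesis using c by simp
qed

text \<open>Shifts are told apart by the leading coefficient: passing from the shift
  \<open>k\<close> to a smaller \<open>n\<close> multiplies it by \<open>r ^ 2 < 1\<close>, while
  equal profiles would force \<open>1 \<le> r ^ 2\<close> in the limit.\<close>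

lemma infinite_solutions: "infinite {Q. sol_on UNIV Q \<and> (Q \<longlongrightarrow> b) at_top}"
proof -
  obtain \<omega> X where \<omega>: "0 < \<omega>" and X: "0 \<le> X" and ex: "\<And>s. 0 \<le> s \<Longrightarrow> \<exists>Q. sol_on UNIV Q \<and>
      (\<forall>x\<ge>X + s. b - tail \<omega> s 1 x \<le> Q x \<and> Q x \<le> b - tail \<omega> s (- 1) x)"
    by (rule asymptotic_solutions) blast
  have "\<exists>q. \<forall>n. sol_on UNIV (q n) \<and>
      (\<forall>x\<ge>X + real n. b - tail \<omega> n 1 x \<le> q n x \<and> q n x \<le> b - tail \<omega> n (- 1) x)"
    by (rule choice) (use ex in auto)
  then obtain q where sol: "\<And>n. sol_on UNIV (q n)"
    and lo: "\<And>n x. X + real n \<le> x \<Longrightarrow> b - tail \<omega> n 1 x \<le> q n x"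
    and hi: "\<And>n x. X + real n \<le> x \<Longrightarrow> q n x \<le> b - tail \<omega> n (- 1) x"
    by blast
  have lim: "(q n \<longlongrightarrow> b) at_top" for n
  proof (rule tendsto_sandwich)
    have "((\<lambda>x. b - tail \<omega> n 1 x) \<longlongrightarrow> b - (0 ^ 2 + 1 * 0 ^ 3)) at_top"
      unfolding tail_def by (intro tendsto_intros exp_decay_tendsto \<omega>)
    then show "((\<lambda>x. b - tail \<omega> n 1 x) \<longlongrightarrow> b) at_top" by simp
    show "\<forall>\<^sub>F x in at_top. b - tail \<omega> n 1 x \<le> q n x"
      using eventually_ge_at_top[of "X + real n"] by eventually_elim (rule lo)
    show "\<forall>\<^sub>F x in at_top. q n x \<le> b"
      using sol[of n] by (intro always_eventually) (auto simp: sol_on_def intro: admissibleD(2))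
  qed simp
  have neq: "q n \<noteq> q k" if "n < k" for n k
  proof
    assume eq: "q n = q k"
    define r where "r = exp (- (\<omega> * (real k - real n)))"
    have r: "0 < r" "r < 1" using \<omega> that by (auto simp: r_def)
    define E where "E x = exp (- (\<omega> * (x - real k)))" for x
    have E_n: "exp (- (\<omega> * (x - real n))) = r * E x" for x
      by (simp add: r_def E_def exp_add[symmetric] algebra_simps)
    have "1 \<le> r ^ 2 + r ^ 3 * E x + E x" if x: "X + real k \<le> x" for x
    proof -
      have "b - tail \<omega> n 1 x \<le> b - tail \<omega> k (- 1) x"
        using lo[of n x] hi[of k x] eq x \<open>n < k\<close> by simp
      then have "E x ^ 2 * 1 \<le> E x ^ 2 * (r ^ 2 + r ^ 3 * E x + E x)"
        unfolding tail_def E_n E_def[symmetric]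
        by (simp add: power_mult_distrib distrib_left power2_eq_square power3_eq_cube mult_ac)
      moreover have "0 < E x ^ 2" by (simp add: E_def)
      ultimately show ?thesis by (subst (asm) mult_le_cancel_left_pos)
    qed
    then have "\<forall>\<^sub>F x in at_top. 1 \<le> r ^ 2 + r ^ 3 * E x + E x"
      unfolding eventually_at_top_linorder by blast
    moreover have "((\<lambda>x. r ^ 2 + r ^ 3 * E x + E x) \<longlongrightarrow> r ^ 2 + r ^ 3 * 0 + 0) at_top"
      unfolding E_def by (intro tendsto_intros exp_decay_tendsto \<omega>)
    ultimately have "1 \<le> r ^ 2 + r ^ 3 * 0 + 0"
      by (intro tendsto_lowerbound[of _ _ at_top]) auto
    then show False using r power_strict_decreasing[of 0 2 r] by simp
  qed
  have "inj q"
  proof (rule injI)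
    fix n k assume "q n = q k"
    then show "n = k" using neq[of n k] neq[of k n] by (cases n k rule: linorder_cases) auto
  qed
  then have "infinite (range q)" by (rule range_inj_infinite)
  moreover have "range q \<subseteq> {Q. sol_on UNIV Q \<and> (Q \<longlongrightarrow> b) at_top}" using sol lim by auto
  ultimately show ?thesis using finite_subset by blast
qed

text \<open>The two limits exclude decreasing profiles and confine increasing ones to
  \<open>{a..b}\<close>, which makes them admissible.\<close>

lemma monotone_profiles_eq:
  assumes "b < 1"
  shows "monotone_profiles l (\<lambda>u. 1 / F u) Vm Vp a b = {Q. sol_on UNIV Q \<and> (Q \<longlongrightarrow> b) at_top}"
proof (intro set_eqI iffI)
  fix Q assume "Q \<in> monotone_profiles l (\<lambda>u. 1 / F u) Vm Vp a b"
  then have mono: "mono Q \<or> antimono Q" and ftl: "ftl_solution l (\<lambda>u. 1 / F u) Vm Vp Q"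
    and lim: "(Q \<longlongrightarrow> a) at_bot" "(Q \<longlongrightarrow> b) at_top"
    unfolding monotone_profiles_def by auto
  have "\<not> antimono Q"
  proof
    assume "antimono Q"
    have "Q 0 \<le> a"
      by (rule tendsto_lowerbound[OF lim(1) eventually_mono[OF eventually_le_at_bot[of 0]]])
         (use antimonoD[OF \<open>antimono Q\<close>] in auto)
    moreover have "b \<le> Q 0"
      by (rule tendsto_upperbound[OF lim(2) eventually_mono[OF eventually_ge_at_top[of 0]]])
         (use antimonoD[OF \<open>antimono Q\<close>] in auto)
    ultimately show False using a_less by simp
  qed
  then have mono: "mono Q" using mono by simp
  have "a \<le> Q x" for x
    by (rule tendsto_upperbound[OF lim(1) eventually_mono[OF eventually_le_at_bot[of x]]])
       (use monoD[OF mono] in auto)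
  moreover have "Q x \<le> b" for x
    by (rule tendsto_lowerbound[OF lim(2) eventually_mono[OF eventually_ge_at_top[of x]]])
       (use monoD[OF mono] in auto)
  ultimately have "admissible Q" using mono unfolding admissible_def by auto
  then show "Q \<in> {Q. sol_on UNIV Q \<and> (Q \<longlongrightarrow> b) at_top}"
    using ftl_solution_imp_sol ftl lim by auto
next
  fix Q assume "Q \<in> {Q. sol_on UNIV Q \<and> (Q \<longlongrightarrow> b) at_top}"
  then have Q: "sol_on UNIV Q" "(Q \<longlongrightarrow> b) at_top" by auto
  then have adm: "admissible Q" unfolding sol_on_def by auto
  have "range Q \<subseteq> {0<..<1}"
    using le_less_trans[OF admissibleD(2)[OF adm] assms] admissibleD(4)[OF adm] by auto
  moreover have "mono Q" using adm unfolding admissible_def by auto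
  ultimately show "Q \<in> monotone_profiles l (\<lambda>u. 1 / F u) Vm Vp a b"
    unfolding monotone_profiles_def using sol_imp_ftl_solution[OF Q(1)] sol_at_bot[OF Q(1)] Q(2) by auto
qed

end

section \<open>One-sided calculus on closed intervals and the passage to the given data\<close>

lemma unit_deriv_has_derivative:
  assumes "f differentiable_on {0..1}" "u \<in> {0..1}"
  shows "(f has_real_derivative unit_deriv f u) (at u within {0..1})"
  using assms unfolding differentiable_on_def unit_deriv_def vector_derivative_works
    has_real_derivative_iff_has_vector_derivative by blast

lemma unit_deriv_eqI:
  assumes "(f has_real_derivative D) (at u within {0..1})" "u \<in> {0..1}"
  shows "unit_deriv f u = D"
  unfolding unit_deriv_def using assms
  by (intro vector_derivative_within_closed_interval)
     (simp_all add: has_real_derivative_iff_has_vector_derivative)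

lemma unit_mvt:
  fixes f f' :: "real \<Rightarrow> real"
  assumes "\<And>u. u \<in> {0..1} \<Longrightarrow> (f has_real_derivative f' u) (at u within {0..1})"
    and "0 \<le> u" "u < v" "v \<le> 1"
  obtains w where "u < w" "w < v" "f v - f u = f' w * (v - u)"
proof -
  have "\<exists>w\<in>{u<..<v}. f v - f u = (*) (f' w) (v - u)"
  proof (rule mvt_simple[OF assms(3)])
    fix x assume "u \<le> x" "x \<le> v"
    then show "(f has_derivative (*) (f' x)) (at x within {u..v})"
      using has_field_derivative_subset[OF assms(1)[of x], of "{u..v}"] assms(2-4)
      by (simp add: has_field_derivative_def)
  qed
  then show thesis using that by auto
qed

text \<open>Near \<open>b\<close> the bound comes from the derivative at \<open>b\<close>; at
  distance \<open>d\<close> or more it comes from the boundedness of \<open>g\<close>.\<close>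

lemma differentiable_imp_lipschitz_at_end:
  fixes g :: "real \<Rightarrow> real"
  assumes "a < b" and g: "g differentiable_on {a..b}"
  obtains K where "\<And>u. u \<in> {a..b} \<Longrightarrow> \<bar>g u - g b\<bar> \<le> K * (b - u)"
proof -
  have "compact (g ` {a..b})"
    using differentiable_imp_continuous_on[OF g] compact_Icc compact_continuous_image by blast
  then obtain B where B: "\<And>u. u \<in> {a..b} \<Longrightarrow> \<bar>g u\<bar> \<le> B"
    using compact_imp_bounded[THEN bounded_real[THEN iffD1]] by (metis imageI)
  obtain D where "(g has_real_derivative D) (at b within {a..b})"
    using g assms(1) unfolding differentiable_on_def real_differentiable_def by force
  then have "((\<lambda>u. (g u - g b) / (u - b)) \<longlongrightarrow> D) (at b within {a..b})"
    by (simp add: has_field_derivative_iff)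
  then have "\<forall>\<^sub>F u in at b within {a..b}. dist ((g u - g b) / (u - b)) D < 1"
    by (rule tendstoD) simp
  then obtain d where d: "0 < d" "\<And>u. u \<in> {a..b} \<Longrightarrow> u \<noteq> b \<Longrightarrow> dist u b < d \<Longrightarrow> dist ((g u - g b) / (u - b)) D < 1"
    unfolding eventually_at by blast
  define K where "K = \<bar>D\<bar> + 1 + 2 * B / d"
  have "0 \<le> B" using B[of a] assms(1) by simp
  have "\<bar>g u - g b\<bar> \<le> K * (b - u)" if u: "u \<in> {a..b}" for u
  proof (cases "u = b")
    case False
    then have pos: "0 < b - u" using u by simp
    show ?thesis
    proof (cases "b - u < d")
      case True
      then have "\<bar>(g u - g b) / (u - b)\<bar> \<le> \<bar>D\<bar> + 1"
        using d(2)[OF u False] pos unfolding dist_real_def by linarith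
      also have "\<dots> \<le> K" using \<open>0 \<le> B\<close> d(1) by (simp add: K_def)
      finally have "\<bar>g u - g b\<bar> / (b - u) \<le> K" using pos by (simp add: abs_divide abs_minus_commute)
      then show ?thesis using pos by (simp add: pos_divide_le_eq)
    next
      case False
      have "\<bar>g u - g b\<bar> \<le> 2 * B" using B[OF u] B[of b] assms(1) by simp
      also have "\<dots> \<le> 2 * B / d * (b - u)"
        using False \<open>0 \<le> B\<close> d(1) mult_left_mono[of d "b - u" "2 * B / d"] by simp
      also have "\<dots> \<le> K * (b - u)"
        using pos by (intro mult_right_mono) (auto simp: K_def)
      finally show ?thesis .
    qed
  qed simp
  then show thesis using that by blast
qed

theorem corollary3p1:
  fixes l Vm Vp \<rho>m \<rho>p \<rho>star \<rho>1 c0 c0hat :: real and \<phi> :: "real \<Rightarrow> real"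
  assumes "l > 0"
    and "\<phi> \<in> {0..1} \<rightarrow> {0..1}" and "\<phi> 0 = 1" and "\<phi> 1 = 0"
    and "\<phi> differentiable_on {0..1}" and "unit_deriv \<phi> differentiable_on {0..1}"
    and "c0hat > 0" and "\<And>\<rho>. \<rho> \<in> {0..1} \<Longrightarrow> unit_deriv \<phi> \<rho> \<le> - c0hat"
    and "c0 > 0"
    and "\<And>\<rho>. \<rho> \<in> {0..1} \<Longrightarrow> unit_deriv (unit_deriv (flux Vm \<phi>)) \<rho> \<le> - c0"
    and "\<And>\<rho>. \<rho> \<in> {0..1} \<Longrightarrow> unit_deriv (unit_deriv (flux Vp \<phi>)) \<rho> \<le> - c0"
    and "\<rho>star \<in> {0<..<1}"
    and "unit_deriv (flux Vm \<phi>) \<rho>star = 0" and "unit_deriv (flux Vp \<phi>) \<rho>star = 0"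
    and "Vm > Vp" and "Vp > 0"
    and "0 < \<rho>m" and "\<rho>m < \<rho>star" and "\<rho>star < \<rho>p" and "\<rho>p < 1"
    and "flux Vm \<phi> \<rho>m = flux Vp \<phi> \<rho>p"
    and "0 \<le> \<rho>1" and "\<rho>1 < \<rho>star" and "flux Vp \<phi> \<rho>1 = flux Vp \<phi> \<rho>p"
  shows "infinite (monotone_profiles l \<phi> Vm Vp \<rho>m \<rho>p) \<and>
    pairwise (\<lambda>Q P. \<forall>x. Q x \<noteq> P x) (monotone_profiles l \<phi> Vm Vp \<rho>m \<rho>p) \<and>
    (\<forall>Q \<in> monotone_profiles l \<phi> Vm Vp \<rho>m \<rho>p. \<rho>1 < Q 0 \<and> Q 0 \<le> \<rho>p)"
proof -
  define D where "D = unit_deriv \<phi>"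
  have D: "(\<phi> has_real_derivative D u) (at u within {0..1})" if "u \<in> {0..1}" for u
    unfolding D_def using unit_deriv_has_derivative[OF assms(5) that] .
  have D_neg: "D u \<le> - c0hat" if "u \<in> {0..1}" for u
    using assms(8)[OF that] by (simp add: D_def)
  have \<phi>_pos: "0 < \<phi> u" if uv: "0 \<le> u" "u < 1" for u
  proof -
    obtain w where "u < w" "w < 1" "\<phi> 1 - \<phi> u = D w * (1 - u)"
      using unit_mvt[OF D uv(1,2) order_refl] by blast
    moreover have "D w * (1 - u) < 0"
      using D_neg[of w] assms(7) that \<open>u < w\<close> \<open>w < 1\<close> by (intro mult_neg_pos) auto
    ultimately show ?thesis using assms(4) by simp
  qed
  have \<phi>_le: "\<phi> u \<le> 1" if "0 \<le> u" "u \<le> 1" for u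
    using assms(2) that by (auto simp: Pi_iff)

  \<comment> \<open>The two fluxes are proportional, so the derivative of one of them describes the
    monotone branches of both.\<close>
  define G where "G = unit_deriv (flux Vp \<phi>)"
  have flux_deriv: "(flux Vp \<phi> has_real_derivative Vp * (\<phi> u + u * D u)) (at u within {0..1})"
    if "u \<in> {0..1}" for u
    unfolding flux_def[abs_def]
    by (rule derivative_eq_intros D[OF that] refl | simp add: algebra_simps)+
  have G_eq: "G u = Vp * (\<phi> u + u * D u)" if "u \<in> {0..1}" for u
    unfolding G_def using unit_deriv_eqI[OF flux_deriv[OF that] that] .
  have diff: "(\<lambda>u. Vp * (\<phi> u + u * D u)) differentiable_on {0..1}"
    using assms(5,6) unfolding D_def by (intro derivative_intros) auto
  have "G differentiable_on {0..1}"
    unfolding differentiable_on_def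
  proof
    fix x :: real assume x: "x \<in> {0..1}"
    then have "(\<lambda>u. Vp * (\<phi> u + u * D u)) differentiable at x within {0..1}"
      using diff unfolding differentiable_on_def by blast
    then show "G differentiable at x within {0..1}"
      by (rule differentiable_transform_within[OF _ zero_less_one x]) (simp add: G_eq)
  qed
  then have G_deriv: "(G has_real_derivative unit_deriv G u) (at u within {0..1})" if "u \<in> {0..1}" for u
    using unit_deriv_has_derivative that by blast
  have G_strict: "G v < G u" if uv: "0 \<le> u" "u < v" "v \<le> 1" for u v
  proof -
    obtain w where w: "u < w" "w < v" "G v - G u = unit_deriv G w * (v - u)"
      using unit_mvt[OF G_deriv uv] by blast
    moreover have "unit_deriv G w * (v - u) < 0"
      using assms(11)[of w] assms(9) w that by (intro mult_neg_pos) (auto simp: G_def)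
    ultimately show ?thesis by simp
  qed
  have star: "0 < \<rho>star" "\<rho>star < 1" "G \<rho>star = 0" using assms by (auto simp: G_def)
  have flux_deriv': "(flux Vp \<phi> has_real_derivative G u) (at u within {0..1})" if "u \<in> {0..1}" for u
    using flux_deriv[OF that] G_eq[OF that] by simp
  have flux_incr: "flux Vp \<phi> u < flux Vp \<phi> v" if uv: "0 \<le> u" "u < v" "v \<le> \<rho>star" for u v
  proof -
    have "v \<le> 1" using that star by simp
    then obtain w where w: "u < w" "w < v" "flux Vp \<phi> v - flux Vp \<phi> u = G w * (v - u)"
      using unit_mvt[OF flux_deriv' uv(1,2)] by blast
    moreover have "0 < G w" using G_strict[of w \<rho>star] w that star by simp
    then have "0 < G w * (v - u)" using that by simp
    ultimately show ?thesis by simp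
  qed
  have flux_decr: "flux Vp \<phi> v < flux Vp \<phi> u" if uv: "\<rho>star \<le> u" "u < v" "v \<le> 1" for u v
  proof -
    have "0 \<le> u" using that star by simp
    then obtain w where w: "u < w" "w < v" "flux Vp \<phi> v - flux Vp \<phi> u = G w * (v - u)"
      using unit_mvt[OF flux_deriv' _ uv(2,3)] by blast
    moreover have "G w < 0" using G_strict[of \<rho>star w] w that star by simp
    then have "G w * (v - u) < 0" using that by (simp add: mult_neg_pos)
    ultimately show ?thesis by simp
  qed
  have flux_scale: "Vp * flux Vm \<phi> u = Vm * flux Vp \<phi> u" for u by (simp add: flux_def)

  define fbar where "fbar = flux Vp \<phi> \<rho>p"
  have fbar: "0 < fbar" using \<phi>_pos[of \<rho>p] assms by (simp add: fbar_def flux_def)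
  define F where "F u = 1 / \<phi> u" for u
  define F' where "F' u = - D u / (\<phi> u)\<^sup>2" for u
  have sub: "u \<in> {0..1}" "0 < \<phi> u" if "u \<in> {\<rho>m..\<rho>p}" for u
    using that assms \<phi>_pos[of u] by auto
  have sub': "{\<rho>m..\<rho>p} \<subseteq> {0..1}" using sub by blast
  have "D differentiable_on {\<rho>m..\<rho>p}" "\<phi> differentiable_on {\<rho>m..\<rho>p}"
    using assms(5,6) sub' unfolding D_def by (auto intro: differentiable_on_subset)
  then have F'_diff: "F' differentiable_on {\<rho>m..\<rho>p}"
    unfolding F'_def[abs_def] differentiable_on_def using sub(2)
    by (auto intro!: differentiable_divide differentiable_minus differentiable_power
        simp: order_less_imp_not_eq2)
  have ab: "\<rho>m < \<rho>p" using assms by simp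
  obtain K where K: "\<And>u. u \<in> {\<rho>m..\<rho>p} \<Longrightarrow> \<bar>F' u - F' \<rho>p\<bar> \<le> K * (\<rho>p - u)"
    using differentiable_imp_lipschitz_at_end[OF ab F'_diff] by blast
  have "compact (F' ` {\<rho>m..\<rho>p})"
    using differentiable_imp_continuous_on[OF F'_diff] compact_Icc compact_continuous_image by blast
  then have "bdd_above (F' ` {\<rho>m..\<rho>p})"
    by (intro bounded_imp_bdd_above compact_imp_bounded)
  then obtain M where M: "\<And>u. u \<in> {\<rho>m..\<rho>p} \<Longrightarrow> F' u \<le> M"
    unfolding bdd_above_def by blast

  \<comment> \<open>\<open>l / fbar\<close> is the time needed at the common flux to cover the
    spacing of the cars; \<open>c0hat\<close> bounds
    \<open>F' u = - D u / (\<phi> u)\<^sup>2\<close> from below because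
    \<open>\<phi> u \<le> 1\<close>.\<close>
  interpret traffic l Vm Vp \<rho>m \<rho>p "l / fbar" c0hat M K F F'
  proof
    show "(F has_real_derivative F' u) (at u within {\<rho>m..\<rho>p})" if "u \<in> {\<rho>m..\<rho>p}" for u
    proof -
      have "(\<phi> has_real_derivative D u) (at u within {\<rho>m..\<rho>p})"
        using D[OF sub(1)[OF that]] sub' by (rule has_field_derivative_subset)
      then show ?thesis
        unfolding F_def[abs_def] F'_def using sub(2)[OF that]
        by (auto intro!: derivative_eq_intros simp: power2_eq_square)
    qed
    show "c0hat \<le> F' u" if "u \<in> {\<rho>m..\<rho>p}" for u
    proof -
      have "(\<phi> u)\<^sup>2 \<le> 1" using \<phi>_le[of u] sub[OF that] by (simp add: power_le_one)
      then have "c0hat * (\<phi> u)\<^sup>2 \<le> c0hat" using assms(7) by (simp add: mult_left_le)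
      also have "\<dots> \<le> - D u" using D_neg[OF sub(1)[OF that]] by simp
      finally show ?thesis
        unfolding F'_def using sub(2)[OF that] by (subst pos_le_divide_eq) auto
    qed
    show "0 < F \<rho>m" using sub(2)[of \<rho>m] ab by (simp add: F_def)
    show "0 < l / fbar" using fbar assms(1) by simp
    show "l * F \<rho>m = \<rho>m * Vm * (l / fbar)"
    proof -
      have "fbar = Vm * \<rho>m * \<phi> \<rho>m" using assms(21) by (simp add: fbar_def flux_def)
      then show ?thesis using sub(2)[of \<rho>m] ab assms(15-17) by (simp add: F_def)
    qed
    show "l * F \<rho>p = \<rho>p * Vp * (l / fbar)"
      using sub(2)[of \<rho>p] ab assms(16,17) by (simp add: F_def fbar_def flux_def)
    show "l * F u < u * Vm * (l / fbar)" if u: "\<rho>m < u" "u \<le> \<rho>p" for u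
    proof -
      have pos: "0 < \<phi> u" using sub(2)[of u] u by simp
      \<comment> \<open>Up to \<open>\<rho>star\<close> the flux for \<open>Vm\<close> has risen
        from its value at \<open>\<rho>m\<close>. Beyond it the flux for \<open>Vp\<close> is still
        at least its value at \<open>\<rho>p\<close>, and \<open>Vm > Vp\<close> makes the
        inequality strict.\<close>
      have "fbar < flux Vm \<phi> u"
      proof (cases "u \<le> \<rho>star")
        case True
        then have "flux Vp \<phi> \<rho>m < flux Vp \<phi> u" using flux_incr[of \<rho>m u] u assms(17) by simp
        then have "Vp * flux Vm \<phi> \<rho>m < Vp * flux Vm \<phi> u"
          unfolding flux_scale using assms(15,16) by simp
        then show ?thesis using assms(16,21) by (simp add: fbar_def)
      next
        case False
        then have "fbar \<le> flux Vp \<phi> u"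
          using flux_decr[of u \<rho>p] u assms(20) by (cases "u = \<rho>p") (auto simp: fbar_def)
        also have "\<dots> < flux Vm \<phi> u"
          using assms(15,17) u pos by (simp add: flux_def)
        finally show ?thesis .
      qed
      then have "l * fbar < l * (Vm * u * \<phi> u)" using assms(1) by (simp add: flux_def)
      then show ?thesis using pos fbar by (simp add: F_def field_simps)
    qed
    show "F \<rho>p < \<rho>p * F' \<rho>p"
    proof -
      have "G \<rho>p < 0" using G_strict[of \<rho>star \<rho>p] star assms(19,20) by simp
      then have "\<phi> \<rho>p < - (\<rho>p * D \<rho>p)"
        using G_eq[of \<rho>p] sub(1)[of \<rho>p] ab assms(16) by (simp add: mult_less_0_iff)
      then show ?thesis
        using sub(2)[of \<rho>p] ab by (simp add: F_def F'_def field_simps power2_eq_square)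
    qed
  qed (use assms ab K M in auto)

  have "(\<lambda>u. 1 / F u) = \<phi>" by (simp add: F_def)
  then have profiles: "monotone_profiles l \<phi> Vm Vp \<rho>m \<rho>p = {Q. sol_on UNIV Q \<and> (Q \<longlongrightarrow> \<rho>p) at_top}"
    using monotone_profiles_eq[OF assms(20)] by simp
  have at_0: "\<rho>1 < Q 0 \<and> Q 0 \<le> \<rho>p" if Q: "sol_on UNIV Q" "(Q \<longlongrightarrow> \<rho>p) at_top" for Q
  proof
    have adm: "admissible Q" using Q unfolding sol_on_def by auto
    show "Q 0 \<le> \<rho>p" by (rule admissibleD(2)[OF adm])
    show "\<rho>1 < Q 0"
    proof (rule ccontr)
      assume "\<not> \<rho>1 < Q 0"
      \<comment> \<open>\<open>Q 0\<close> lies on the increasing branch below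
        \<open>\<rho>1\<close>, so its flux is at most the common one. As the slowness at 0 itself
        is the one for \<open>Vp\<close>, this is the stationarity condition at 0.\<close>
      then have "flux Vp \<phi> (Q 0) \<le> fbar"
        using flux_incr[of "Q 0" \<rho>1] admissibleD(4)[OF adm, of 0] assms(23,24)
        by (cases "Q 0 = \<rho>1") (auto simp: fbar_def)
      moreover have "0 < flux Vp \<phi> (Q 0)"
        using sub(2)[of "Q 0"] admissibleD[OF adm, of 0] assms(16) by (simp add: flux_def)
      ultimately have "l / fbar \<le> l / flux Vp \<phi> (Q 0)"
        using assms(1) by (intro divide_left_mono) auto
      also have "\<dots> = F (Q 0) / Vp * (l / Q 0)" by (simp add: flux_def F_def)
      finally have "Q 0 = \<rho>p"
        using stationary_imp_b[of Q 0] sol_on_subset[OF Q(1), of "{0..}"] Q(2) by simp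
      then show False using \<open>\<not> \<rho>1 < Q 0\<close> assms(19,23) by simp
    qed
  qed
  show ?thesis
    unfolding profiles
  proof (intro conjI ballI)
    show "infinite {Q. sol_on UNIV Q \<and> (Q \<longlongrightarrow> \<rho>p) at_top}" by (rule infinite_solutions)
    show "pairwise (\<lambda>Q P. \<forall>x. Q x \<noteq> P x) {Q. sol_on UNIV Q \<and> (Q \<longlongrightarrow> \<rho>p) at_top}"
      unfolding pairwise_def using sol_unique_of_crossing by blast
  qed (use at_0 in auto)
qed

end
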